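(* Let $j:\mathcal M\to\mathbb H$ be an embedding of a Hilbert manifold in a Hilbert space, let $X_1,\dots,X_n$ be i.i.d. random objects from a $j$-nonfocal distribution on $\mathcal M$ (that of a random object $X$) with extrinsic mean $\mu_E$ and extrinsic covariance operator $\Sigma_j$, and let $\delta>0$. If $\mathbf M_0=\{m_0\}$, where $m_0$ is a point on $\mathcal M$, then the test statistic for the hypotheses $$H_0:\ \mu_E\in \mathbf M_0^\delta\cup\mathbf B_0^{\delta,X},\qquad H_A:\ \mu_E\in(\mathbf M_0^\delta)^c\cap(\mathbf B_0^{\delta,X})^c$$ has an asymptotically standard normal distribution and is given by $$T_n=\sqrt n\,\{\varphi_{m_0}(\hat\mu_E)-\delta^2\}/s_n,$$ where $$s_n^2=4\langle\hat\nu,S_{E,n}\hat\nu\rangle,$$ $$S_{E,n}=\frac1n\sum_{i=1}^n\Big(\tan_{j(\hat\mu_{E,n})}d_{\overline{j(X)}_n}P_j\big(j(X_i)-\overline{j(X)}_n\big)\Big)\otimes\Big(\tan_{j(\hat\mu_{E,n})}d_{\overline{j(X)}_n}P_j\big(j(X_i)-\overline{j(X)}_n\big)\Big)$$ is the extrinsic sample covariance operator for $\{X_i\}_{i=1}^n$, and $$\hat\nu=(d_{\hat\mu_{E,n}}j)^{-1}\tan_{j(\hat\mu_{E,n})}\big(j(m_0)-j(\hat\mu_{E,n})\big).$$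
   Context: Hilbert spaces are real, separable and infinite dimensional. Differentiability is in the Fréchet sense, and $d_xf$ denotes the differential of $f$ at $x$. A Hilbert manifold is a separable metric space $\mathcal M$ that admits an open covering by domains of charts (homeomorphisms of open subsets of $\mathcal M$ into a Hilbert space) with differentiable transition maps. An embedding $j:\mathcal M\to\mathbb H$ of a Hilbert manifold in a Hilbert space is a one-to-one differentiable function such that each differential $d_xj$ is one-to-one, the range $j(\mathcal M)$ is a closed subset of $\mathbb H$, and the topology of $\mathcal M$ is induced via $j$ by that of $\mathbb H$. A random object $X$ on $\mathcal M$ is $j$-nonfocal if there is a unique point of $j(\mathcal M)$ at minimum distance from $\mu=E(j(X))$. $P_j$ denotes the projection onto $j(\mathcal M)$, sending a point of $\mathbb H$ to the unique nearest point of $j(\mathcal M)$ where such a point is unique. The extrinsic mean of $X$ is the unique minimizer over $x\in\mathcal M$ of $E(\|j(X)-j(x)\|^2)$; it equals $\mu_E=j^{-1}(P_j(\mu))$. With $\overline{j(X)}_n=\frac1n\sum_{i=1}^n j(X_i)$, the extrinsic sample mean $\hat\mu_E=\hat\mu_{E,n}$ is $j^{-1}(P_j(\overline{j(X)}_n))$, which is well defined with probability one for $n$ large enough. For $q\in j(\mathcal M)$ and $v\in\mathbb H$, $\tan_q(v)=\sum_a\langle e_a(q),v\rangle e_a(q)$ is the tangential component of $v$, where $e_a(q)$, $a=1,2,\dots$, is an orthonormal basis of the tangent space $T_qj(\mathcal M)$. For $u\in\mathbb H$, $u\otimes u$ is the operator $v\mapsto\langle v,u\rangle u$. Tangent vectors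 to $\mathcal M$ at $x$ and to $j(\mathcal M)$ at $j(x)$ correspond via $d_xj$; scalar products and operators are understood through this correspondence. Let $\tilde\Sigma=\mathrm{cov}(j(X))$ be the covariance operator of $j(X)$. The extrinsic covariance operator $\Sigma_j$ of $X$ is the operator on $T_{\mu_E}\mathcal M$ represented, with respect to the basis $f_a=(d_{\mu_E}j)^{-1}(e_a(P_j(\mu)))$, $a=1,2,\dots$, by the infinite matrix $B\tilde\Sigma B^T$, where $B$ has entries $\langle d_\mu P_j(e_b),e_a(P_j(\mu))\rangle$, with $(e_b)$ an orthonormal basis of $\mathbb H$ in which $\tilde\Sigma$ is represented. For $\mathbf M_0=\{m_0\}$, $\varphi_{m_0}:\mathcal M\to\mathbb R$ is $\varphi_{m_0}(p)=\|j(p)-j(m_0)\|^2$, and $$\mathbf M_0^\delta=\{p\in\mathcal M:\varphi_{m_0}(p)\le\delta^2\},\qquad \mathbf B_0^\delta=\{p\in\mathcal M:\varphi_{m_0}(p)=\delta^2\}.$$ For all small enough $\delta>0$, $\mathbf B_0^\delta$ is a Hilbert submanifold of codimension one in $\mathcal M$. For $p\in\mathbf B_0^\delta$, $\nu_p$ is the normal space at $p$, the orthocomplement of the tangent space to $\mathbf B_0^\delta$ at $p$, and $$\mathbf B_0^{\delta,X}=\{p\in\mathbf B_0^\delta:\ \Sigma_j|_{\nu_p}\text{ is positive definite}\}.$$ The superscript $c$ denotes complement in $\mathcal M$.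
   Formalization: The normal limit is proved for μ_E in B_0^{δ,X} only (it fails for φ(μ_E)<δ²), assuming E‖j(X)‖²<∞, P_j well defined and C¹ near μ, closed tangent spaces of j(M), and the differential of φ_{m_0} nonzero on B_0^δ, in place of δ small. *)

theory Defs
  imports "HOL-Probability.Probability"
begin

section \<open>Hilbert manifolds and embeddings\<close>

text \<open>
  A Hilbert space is a type of sort \<open>{real_inner, banach, second_countable_topology}\<close> that is
  infinite dimensional. A separable metric space is a type of sort
  \<open>{metric_space, second_countable_topology}\<close>.
\<close>

definition infinite_dimensional :: "'a::real_vector itself \<Rightarrow> bool" where
  "infinite_dimensional _ \<longleftrightarrow> (\<nexists>B::'a set. finite B \<and> span B = UNIV)"

type_synonym ('m, 'c) chart = "'m set \<times> ('m \<Rightarrow> 'c)"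

definition is_chart :: "('m::metric_space, 'c::real_normed_vector) chart \<Rightarrow> bool" where
  "is_chart c \<longleftrightarrow> (case c of (U, \<psi>) \<Rightarrow>
     open U \<and> open (\<psi> ` U) \<and> homeomorphism U (\<psi> ` U) \<psi> (inv_into U \<psi>))"

definition hilbert_manifold ::
    "('m::{metric_space, second_countable_topology},
      'c::{real_inner, banach, second_countable_topology}) chart set \<Rightarrow> bool" where
  "hilbert_manifold A \<longleftrightarrow>
     infinite_dimensional TYPE('c) \<and>
     (\<forall>c\<in>A. is_chart c) \<and>
     (\<Union>c\<in>A. fst c) = UNIV \<and>
     (\<forall>(U, \<psi>)\<in>A. \<forall>(V, \<psi>')\<in>A. (\<psi>' \<circ> inv_into U \<psi>) differentiable_on \<psi> ` (U \<inter> V))"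

definition local_rep :: "('m, 'c) chart \<Rightarrow> ('m \<Rightarrow> 'b) \<Rightarrow> 'c \<Rightarrow> 'b" where
  "local_rep c f = f \<circ> inv_into (fst c) (snd c)"

definition differentiable_map ::
    "('m, 'c::real_normed_vector) chart set \<Rightarrow> ('m \<Rightarrow> 'b::real_normed_vector) \<Rightarrow> bool" where
  "differentiable_map A f \<longleftrightarrow> (\<forall>c\<in>A. local_rep c f differentiable_on snd c ` fst c)"

text \<open>
  The tangent space at \<open>x\<close> is the model space \<open>'c\<close>, a tangent vector being represented in the
  chart \<open>chart_at A x\<close>. Another choice of chart changes the representatives by an invertible
  linear map, and everything below that takes values in the reals or in the ambient Hilbert
  space is unaffected by it.
\<close>

definition chart_at :: "('m, 'c) chart set \<Rightarrow> 'm \<Rightarrow> ('m, 'c) chart" where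
  "chart_at A x = (SOME c. c \<in> A \<and> x \<in> fst c)"

definition differential ::
    "('m, 'c::real_normed_vector) chart set \<Rightarrow> ('m \<Rightarrow> 'b::real_normed_vector) \<Rightarrow> 'm \<Rightarrow> 'c \<Rightarrow> 'b" where
  "differential A f x =
     frechet_derivative (local_rep (chart_at A x) f) (at (snd (chart_at A x) x))"

definition hilbert_embedding ::
    "('m::{metric_space, second_countable_topology},
      'c::{real_inner, banach, second_countable_topology}) chart set
     \<Rightarrow> ('m \<Rightarrow> 'h::{real_inner, banach, second_countable_topology}) \<Rightarrow> bool" where
  "hilbert_embedding A j \<longleftrightarrow>
     inj j \<and> differentiable_map A j \<and>
     (\<forall>x. inj (differential A j x)) \<and>
     closed (range j) \<and>
     (\<forall>S. open S \<longleftrightarrow> (\<exists>V. open V \<and> S = j -` V))"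

text \<open>The tangent space of \<open>j(M)\<close> at a point \<open>q\<close> of \<open>j(M)\<close>.\<close>

definition tangent_image ::
    "('m, 'c::real_normed_vector) chart set \<Rightarrow> ('m \<Rightarrow> 'h::real_normed_vector) \<Rightarrow> 'h \<Rightarrow> 'h set" where
  "tangent_image A j q = range (differential A j (inv j q))"

text \<open>Scalar product of \<open>T\<^sub>xM\<close>, carried over from the ambient space by the differential of \<open>j\<close>.\<close>

definition tangent_inner ::
    "('m, 'c::real_normed_vector) chart set \<Rightarrow> ('m \<Rightarrow> 'h::real_inner) \<Rightarrow> 'm \<Rightarrow> 'c \<Rightarrow> 'c \<Rightarrow> real" where
  "tangent_inner A j x u v = inner (differential A j x u) (differential A j x v)"

definition orthonormal_basis :: "(nat \<Rightarrow> 'h::real_inner) \<Rightarrow> 'h set \<Rightarrow> bool" where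
  "orthonormal_basis e S \<longleftrightarrow>
     range e \<subseteq> S \<and>
     (\<forall>a b. inner (e a) (e b) = (if a = b then 1 else 0)) \<and>
     S \<subseteq> closure (span (range e))"

text \<open>Tangential component; \<open>e q\<close> is an orthonormal basis of \<open>tangent_image A j q\<close>.\<close>

definition tangential :: "('h \<Rightarrow> nat \<Rightarrow> 'h::real_inner) \<Rightarrow> 'h \<Rightarrow> 'h \<Rightarrow> 'h" where
  "tangential e q v = (\<Sum>a. inner (e q a) v *\<^sub>R e q a)"


section \<open>Projection, extrinsic mean and extrinsic covariance\<close>

definition nearest_points :: "('m \<Rightarrow> 'h::real_normed_vector) \<Rightarrow> 'h \<Rightarrow> 'h set" where
  "nearest_points j y = {q \<in> range j. \<forall>q'\<in>range j. norm (y - q) \<le> norm (y - q')}"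

definition proj_onto :: "('m \<Rightarrow> 'h::real_normed_vector) \<Rightarrow> 'h \<Rightarrow> 'h" where
  "proj_onto j y = (THE q. q \<in> nearest_points j y)"

text \<open>
  The largest open set on which the projection onto \<open>j(M)\<close> is well defined and continuously
  Frechet differentiable.
\<close>

definition proj_domain :: "('m \<Rightarrow> 'h::real_normed_vector) \<Rightarrow> 'h set" where
  "proj_domain j = \<Union>{U. open U \<and> (\<forall>y\<in>U. \<exists>!q. q \<in> nearest_points j y) \<and>
     (\<exists>D :: 'h \<Rightarrow> 'h \<Rightarrow>\<^sub>L 'h. continuous_on U D \<and>
        (\<forall>y\<in>U. (proj_onto j has_derivative blinfun_apply (D y)) (at y)))}"

definition mean_vector :: "'w measure \<Rightarrow> ('m \<Rightarrow> 'h::{banach, second_countable_topology})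
    \<Rightarrow> ('w \<Rightarrow> 'm) \<Rightarrow> 'h" where
  "mean_vector P j X = (\<integral>\<omega>. j (X \<omega>) \<partial>P)"

definition nonfocal :: "'w measure \<Rightarrow> ('m \<Rightarrow> 'h::{banach, second_countable_topology})
    \<Rightarrow> ('w \<Rightarrow> 'm) \<Rightarrow> bool" where
  "nonfocal P j X \<longleftrightarrow> (\<exists>!q. q \<in> nearest_points j (mean_vector P j X))"

definition extrinsic_mean :: "'w measure \<Rightarrow> ('m \<Rightarrow> 'h::real_normed_vector) \<Rightarrow> ('w \<Rightarrow> 'm) \<Rightarrow> 'm" where
  "extrinsic_mean P j X =
     (THE x. \<forall>x'. (\<integral>\<omega>. (norm (j (X \<omega>) - j x))\<^sup>2 \<partial>P) \<le> (\<integral>\<omega>. (norm (j (X \<omega>) - j x'))\<^sup>2 \<partial>P))"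

definition tensor_square :: "'h::real_inner \<Rightarrow> 'h \<Rightarrow> 'h" where
  "tensor_square u v = inner v u *\<^sub>R u"

definition cov_operator ::
    "'w measure \<Rightarrow> ('m \<Rightarrow> 'h::{real_inner, banach, second_countable_topology}) \<Rightarrow> ('w \<Rightarrow> 'm)
     \<Rightarrow> 'h \<Rightarrow> 'h" where
  "cov_operator P j X v = (\<integral>\<omega>. tensor_square (j (X \<omega>) - mean_vector P j X) v \<partial>P)"

type_synonym infinite_matrix = "nat \<Rightarrow> nat \<Rightarrow> real"

definition inf_mat_mult :: "infinite_matrix \<Rightarrow> infinite_matrix \<Rightarrow> infinite_matrix" where
  "inf_mat_mult F G = (\<lambda>a c. \<Sum>b. F a b * G b c)"

definition inf_mat_transpose :: "infinite_matrix \<Rightarrow> infinite_matrix" where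
  "inf_mat_transpose F = (\<lambda>a b. F b a)"

text \<open>
  In the next definitions \<open>h\<close> is an orthonormal basis of the ambient Hilbert space, and \<open>e q\<close> one
  of the tangent space of \<open>j(M)\<close> at \<open>q\<close>.
\<close>

definition cov_matrix ::
    "'w measure \<Rightarrow> ('m \<Rightarrow> 'h::{real_inner, banach, second_countable_topology}) \<Rightarrow> ('w \<Rightarrow> 'm)
     \<Rightarrow> (nat \<Rightarrow> 'h) \<Rightarrow> infinite_matrix" where
  "cov_matrix P j X h = (\<lambda>b c. inner (h b) (cov_operator P j X (h c)))"

definition proj_matrix ::
    "'w measure \<Rightarrow> ('m \<Rightarrow> 'h::{real_inner, banach, second_countable_topology}) \<Rightarrow> ('w \<Rightarrow> 'm)
     \<Rightarrow> ('h \<Rightarrow> nat \<Rightarrow> 'h) \<Rightarrow> (nat \<Rightarrow> 'h) \<Rightarrow> infinite_matrix" where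
  "proj_matrix P j X e h = (let \<mu> = mean_vector P j X in
     (\<lambda>a b. inner (frechet_derivative (proj_onto j) (at \<mu>) (h b)) (e (proj_onto j \<mu>) a)))"

text \<open>
  The operator on the tangent space at the extrinsic mean that has matrix \<open>G\<close> with respect to
  the basis \<open>f\<close>, which is orthonormal for \<open>tangent_inner\<close>.
\<close>

definition extrinsic_cov ::
    "('m, 'c::real_normed_vector) chart set \<Rightarrow> 'w measure
     \<Rightarrow> ('m \<Rightarrow> 'h::{real_inner, banach, second_countable_topology}) \<Rightarrow> ('w \<Rightarrow> 'm)
     \<Rightarrow> ('h \<Rightarrow> nat \<Rightarrow> 'h) \<Rightarrow> (nat \<Rightarrow> 'h) \<Rightarrow> 'c \<Rightarrow> 'c" where
  "extrinsic_cov A P j X e h v =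
     (let x = extrinsic_mean P j X;
          q = proj_onto j (mean_vector P j X);
          f = (\<lambda>a. inv (differential A j x) (e q a));
          B = proj_matrix P j X e h;
          G = inf_mat_mult (inf_mat_mult B (cov_matrix P j X h)) (inf_mat_transpose B)
      in \<Sum>a. (\<Sum>a'. G a a' * tangent_inner A j x (f a') v) *\<^sub>R f a)"


section \<open>Neighbourhood hypotheses\<close>

definition sq_dist :: "('m \<Rightarrow> 'h::real_normed_vector) \<Rightarrow> 'm \<Rightarrow> 'm \<Rightarrow> real" where
  "sq_dist j m0 p = (norm (j p - j m0))\<^sup>2"

definition nbhd :: "('m \<Rightarrow> 'h::real_normed_vector) \<Rightarrow> 'm \<Rightarrow> real \<Rightarrow> 'm set" where
  "nbhd j m0 \<delta> = {p. sq_dist j m0 p \<le> \<delta>\<^sup>2}"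

definition bdry :: "('m \<Rightarrow> 'h::real_normed_vector) \<Rightarrow> 'm \<Rightarrow> real \<Rightarrow> 'm set" where
  "bdry j m0 \<delta> = {p. sq_dist j m0 p = \<delta>\<^sup>2}"

text \<open>
  The condition under which \<open>bdry j m0 \<delta>\<close> is a hypersurface with equation
  \<open>sq_dist j m0 p = \<delta>\<^sup>2\<close>. It has to be stated since it can fail for large \<open>\<delta>\<close>: on projective
  space with the embedding \<open>[u] \<mapsto> u \<otimes> u\<close>, the maximum of \<open>sq_dist j m0\<close> is attained on a
  submanifold of codimension one.
\<close>

definition regular_level ::
    "('m, 'c::real_normed_vector) chart set \<Rightarrow> ('m \<Rightarrow> 'h::real_normed_vector) \<Rightarrow> 'm \<Rightarrow> real \<Rightarrow> bool" where
  "regular_level A j m0 \<delta> \<longleftrightarrow>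
     (\<forall>p \<in> bdry j m0 \<delta>. \<exists>v. differential A (sq_dist j m0) p v \<noteq> 0)"

text \<open>Tangent vectors at \<open>p\<close> to a subset \<open>S\<close> of the manifold: velocities of curves in \<open>S\<close>.\<close>

definition tangent_to ::
    "('m, 'c::real_normed_vector) chart set \<Rightarrow> 'm set \<Rightarrow> 'm \<Rightarrow> 'c set" where
  "tangent_to A S p = {v. \<exists>\<gamma> :: real \<Rightarrow> 'm. \<gamma> 0 = p \<and> (\<forall>t. \<gamma> t \<in> S \<inter> fst (chart_at A p)) \<and>
     ((\<lambda>t. snd (chart_at A p) (\<gamma> t)) has_vector_derivative v) (at 0)}"

definition normal_space ::
    "('m, 'c::real_normed_vector) chart set \<Rightarrow> ('m \<Rightarrow> 'h::real_inner) \<Rightarrow> 'm set \<Rightarrow> 'm \<Rightarrow> 'c set" where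
  "normal_space A j S p = {w. \<forall>v \<in> tangent_to A S p. tangent_inner A j p w v = 0}"

text \<open>
  Since \<open>extrinsic_cov\<close> acts on the tangent space at the extrinsic mean, the representatives
  of normal vectors at \<open>p\<close> are meaningful arguments of it only if \<open>p\<close> is the extrinsic mean,
  the only point at which membership is ever asked for.
\<close>

definition bdry_pd ::
    "('m, 'c::real_normed_vector) chart set \<Rightarrow> 'w measure
     \<Rightarrow> ('m \<Rightarrow> 'h::{real_inner, banach, second_countable_topology}) \<Rightarrow> ('w \<Rightarrow> 'm)
     \<Rightarrow> ('h \<Rightarrow> nat \<Rightarrow> 'h) \<Rightarrow> (nat \<Rightarrow> 'h) \<Rightarrow> 'm \<Rightarrow> real \<Rightarrow> 'm set" where
  "bdry_pd A P j X e h m0 \<delta> = {p \<in> bdry j m0 \<delta>.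
     \<forall>w \<in> normal_space A j (bdry j m0 \<delta>) p. w \<noteq> 0 \<longrightarrow>
       tangent_inner A j p w (extrinsic_cov A P j X e h w) > 0}"

definition null_region ::
    "('m, 'c::real_normed_vector) chart set \<Rightarrow> 'w measure
     \<Rightarrow> ('m \<Rightarrow> 'h::{real_inner, banach, second_countable_topology}) \<Rightarrow> ('w \<Rightarrow> 'm)
     \<Rightarrow> ('h \<Rightarrow> nat \<Rightarrow> 'h) \<Rightarrow> (nat \<Rightarrow> 'h) \<Rightarrow> 'm \<Rightarrow> real \<Rightarrow> 'm set" where
  "null_region A P j X e h m0 \<delta> = nbhd j m0 \<delta> \<union> bdry_pd A P j X e h m0 \<delta>"

definition alt_region ::
    "('m, 'c::real_normed_vector) chart set \<Rightarrow> 'w measure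
     \<Rightarrow> ('m \<Rightarrow> 'h::{real_inner, banach, second_countable_topology}) \<Rightarrow> ('w \<Rightarrow> 'm)
     \<Rightarrow> ('h \<Rightarrow> nat \<Rightarrow> 'h) \<Rightarrow> (nat \<Rightarrow> 'h) \<Rightarrow> 'm \<Rightarrow> real \<Rightarrow> 'm set" where
  "alt_region A P j X e h m0 \<delta> = - nbhd j m0 \<delta> \<inter> - bdry_pd A P j X e h m0 \<delta>"

lemma alt_region_eq: "alt_region A P j X e h m0 \<delta> = - null_region A P j X e h m0 \<delta>"
  by (simp add: alt_region_def null_region_def)


section \<open>Sample quantities\<close>

text \<open>The sample of size \<open>n\<close> consists of \<open>x 0, \<dots>, x (n - 1)\<close>.\<close>

definition sample_mean_vector :: "('m \<Rightarrow> 'h::real_normed_vector) \<Rightarrow> nat \<Rightarrow> (nat \<Rightarrow> 'm) \<Rightarrow> 'h" where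
  "sample_mean_vector j n x = (1 / real n) *\<^sub>R (\<Sum>i<n. j (x i))"

definition extrinsic_sample_mean :: "('m \<Rightarrow> 'h::real_normed_vector) \<Rightarrow> nat \<Rightarrow> (nat \<Rightarrow> 'm) \<Rightarrow> 'm" where
  "extrinsic_sample_mean j n x = inv j (proj_onto j (sample_mean_vector j n x))"

text \<open>
  As an operator on the tangent space of \<open>j(M)\<close> at the image of the extrinsic sample mean.
\<close>

definition extrinsic_sample_cov ::
    "('m \<Rightarrow> 'h::real_inner) \<Rightarrow> ('h \<Rightarrow> nat \<Rightarrow> 'h) \<Rightarrow> nat \<Rightarrow> (nat \<Rightarrow> 'm) \<Rightarrow> 'h \<Rightarrow> 'h" where
  "extrinsic_sample_cov j e n x v =
     (let y = sample_mean_vector j n x; q = j (extrinsic_sample_mean j n x)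
      in (1 / real n) *\<^sub>R (\<Sum>i<n. tensor_square
            (tangential e q (frechet_derivative (proj_onto j) (at y) (j (x i) - y))) v))"

definition nu_hat ::
    "('m, 'c::real_normed_vector) chart set \<Rightarrow> ('m \<Rightarrow> 'h::real_inner) \<Rightarrow> ('h \<Rightarrow> nat \<Rightarrow> 'h)
     \<Rightarrow> 'm \<Rightarrow> nat \<Rightarrow> (nat \<Rightarrow> 'm) \<Rightarrow> 'c" where
  "nu_hat A j e m0 n x =
     (let p = extrinsic_sample_mean j n x
      in inv (differential A j p) (tangential e (j p) (j m0 - j p)))"

text \<open>The operator \<open>extrinsic_sample_cov\<close> is applied to \<open>nu_hat\<close> through the differential of \<open>j\<close>.\<close>

definition sample_var ::
    "('m, 'c::real_normed_vector) chart set \<Rightarrow> ('m \<Rightarrow> 'h::real_inner) \<Rightarrow> ('h \<Rightarrow> nat \<Rightarrow> 'h)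
     \<Rightarrow> 'm \<Rightarrow> nat \<Rightarrow> (nat \<Rightarrow> 'm) \<Rightarrow> real" where
  "sample_var A j e m0 n x =
     (let w = differential A j (extrinsic_sample_mean j n x) (nu_hat A j e m0 n x)
      in 4 * inner w (extrinsic_sample_cov j e n x w))"

text \<open>
  The statistic is given the value \<open>0\<close> on the event, of probability tending to \<open>0\<close>, that the
  projection is not defined and continuously differentiable around the sample mean vector.
\<close>

definition test_statistic ::
    "('m, 'c::real_normed_vector) chart set \<Rightarrow> ('m \<Rightarrow> 'h::real_inner) \<Rightarrow> ('h \<Rightarrow> nat \<Rightarrow> 'h)
     \<Rightarrow> 'm \<Rightarrow> real \<Rightarrow> nat \<Rightarrow> (nat \<Rightarrow> 'm) \<Rightarrow> real" where
  "test_statistic A j e m0 \<delta> n x =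
     (if sample_mean_vector j n x \<in> proj_domain j
      then sqrt (real n) * (sq_dist j m0 (extrinsic_sample_mean j n x) - \<delta>\<^sup>2)
             / sqrt (sample_var A j e m0 n x)
      else 0)"

end

theory Submission imports Defs begin

text \<open>
  Put \<open>Y i = j (Xs i)\<close> and \<open>\<mu> = E (j X)\<close>, write \<open>\<pi>\<close> for the projection onto \<open>j(M)\<close>, and let
  \<open>G y = \<parallel>\<pi> y - j m0\<parallel>\<^sup>2\<close>. With \<open>y\<close> the average of \<open>Y 0, \<dots>, Y (n - 1)\<close>, the numerator of the statistic is
  \<open>\<surd>n (G y - \<delta>\<^sup>2)\<close>. The extrinsic mean is \<open>j\<^sup>-\<^sup>1 (\<pi> \<mu>)\<close> (lemma \<open>extrinsic_mean_eq\<close>), so on the boundary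
  \<open>G \<mu> = \<delta>\<^sup>2\<close>, and the delta method applies to \<open>G\<close> at \<open>\<mu>\<close>: the numerator behaves like
  \<open>1/\<surd>n \<Sum>i G'(\<mu>) (Y i - \<mu>)\<close>, a normalised sum of real i.i.d. variables. It remains to see that the
  denominator estimates the standard deviation of \<open>G'(\<mu>) (Y 0 - \<mu>)\<close> and that this is positive.

  The denominator. A curve in \<open>j(M)\<close> has its velocity in the tangent space, hence the differential of
  \<open>\<pi>\<close> at \<open>y\<close> takes values in the tangent space at \<open>\<pi> y\<close> (lemma \<open>proj_deriv_in_tangent_image\<close>). Since
  tangential components are orthogonal projections, both of them disappear from the scalar product
  of \<open>tan (j m0 - \<pi> y)\<close> with \<open>tan (d\<pi> (Y i - y))\<close>, which is thus \<open>- G'(y) (Y i - y) / 2\<close>. Therefore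
  \<open>s_n\<^sup>2 = 1/n \<Sum>i (G'(y) (Y i - y))\<^sup>2\<close> (lemma \<open>sample_var_eq\<close>): the plug-in estimator, in which the
  bases \<open>e q\<close> no longer occur. This formula also yields the measurability of the statistic.

  Positivity. The quadratic form of the extrinsic covariance operator is
  \<open>v \<mapsto> E \<langle>d\<pi> (j X - \<mu>), dj v\<rangle>\<^sup>2\<close> (lemma \<open>extrinsic_cov_quadratic_form\<close>). At the vector \<open>\<nu>\<close> with
  \<open>dj \<nu> = tan (j m0 - \<pi> \<mu>)\<close> it equals \<open>Var (G'(\<mu>) (Y 0 - \<mu>)) / 4\<close>. This \<open>\<nu>\<close> is normal to the level set of
  \<open>sq_dist j m0\<close>, being minus half of the gradient of that function, and nonzero as the level is
  regular (lemma \<open>normal_vector\<close>); so positive definiteness on the normal space gives the claim.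

  The probabilistic part, \<open>studentized_delta_method\<close>, rests on the central limit theorem for
  the real variables \<open>G'(\<mu>) (Y i - \<mu>)\<close>, on the identity \<open>E \<parallel>y - \<mu>\<parallel>\<^sup>2 = E \<parallel>Y 0 - \<mu>\<parallel>\<^sup>2 / n\<close>, which controls the
  remainder of the expansion of \<open>G\<close> in the Hilbert space, and on the weak law of large
  numbers for \<open>(G'(\<mu>) (Y i - \<mu>))\<^sup>2\<close>.
\<close>

section \<open>Orthonormal expansions\<close>

lemma norm_sum_orthonormal:
  fixes e :: "nat \<Rightarrow> 'a::real_inner"
  assumes on: "\<And>a b. inner (e a) (e b) = (if a = b then 1 else 0)" and "finite I"
  shows "(norm (\<Sum>a\<in>I. c a *\<^sub>R e a))\<^sup>2 = (\<Sum>a\<in>I. (c a)\<^sup>2)"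
proof -
  have "(norm (\<Sum>a\<in>I. c a *\<^sub>R e a))\<^sup>2 = (\<Sum>a\<in>I. \<Sum>b\<in>I. c a * c b * (if a = b then 1 else 0))"
    by (simp add: power2_norm_eq_inner inner_sum_left inner_sum_right on mult.assoc
        sum_distrib_left eq_commute)
  also have "\<dots> = (\<Sum>a\<in>I. (c a)\<^sup>2)"
    using \<open>finite I\<close> by (intro sum.cong refl) (simp add: if_distrib power2_eq_square cong: if_cong)
  finally show ?thesis .
qed

lemma bessel_inequality:
  fixes e :: "nat \<Rightarrow> 'a::real_inner"
  assumes on: "\<And>a b. inner (e a) (e b) = (if a = b then 1 else 0)" and "finite I"
  shows "(\<Sum>a\<in>I. (inner (e a) v)\<^sup>2) \<le> (norm v)\<^sup>2"
proof -
  let ?p = "\<Sum>a\<in>I. inner (e a) v *\<^sub>R e a"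
  have "inner v ?p = (\<Sum>a\<in>I. (inner (e a) v)\<^sup>2)"
    by (simp add: inner_sum_right power2_eq_square inner_commute)
  moreover have "inner ?p ?p = (\<Sum>a\<in>I. (inner (e a) v)\<^sup>2)"
    using norm_sum_orthonormal[OF assms, of "\<lambda>a. inner (e a) v"]
    by (simp add: power2_norm_eq_inner)
  moreover have "0 \<le> inner (v - ?p) (v - ?p)"
    by simp
  ultimately show ?thesis
    by (simp add: inner_diff_left inner_diff_right inner_commute power2_norm_eq_inner)
qed

lemma summable_orthonormal_expansion:
  fixes e :: "nat \<Rightarrow> 'a::{real_inner, banach}"
  assumes on: "\<And>a b. inner (e a) (e b) = (if a = b then 1 else 0)"
  shows "summable (\<lambda>a. inner (e a) v *\<^sub>R e a)"
  unfolding summable_Cauchy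
proof (intro allI impI)
  fix \<epsilon> :: real
  assume "\<epsilon> > 0"
  have "summable (\<lambda>a. (inner (e a) v)\<^sup>2)"
    by (rule summableI_nonneg_bounded[of _ "(norm v)\<^sup>2"])
      (auto intro: bessel_inequality[OF on])
  then obtain N where N: "\<And>m n. m \<ge> N \<Longrightarrow> norm (\<Sum>a=m..<n. (inner (e a) v)\<^sup>2) < \<epsilon>\<^sup>2"
    unfolding summable_Cauchy using \<open>\<epsilon> > 0\<close> by (meson zero_less_power)
  have "norm (\<Sum>a=m..<n. inner (e a) v *\<^sub>R e a) < \<epsilon>" if "m \<ge> N" for m n
  proof (rule power2_less_imp_less)
    show "(norm (\<Sum>a=m..<n. inner (e a) v *\<^sub>R e a))\<^sup>2 < \<epsilon>\<^sup>2"
      using N[OF that, of n] by (subst norm_sum_orthonormal[OF on]) (auto simp: sum_nonneg)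
  qed (use \<open>\<epsilon> > 0\<close> in simp)
  then show "\<exists>N. \<forall>m\<ge>N. \<forall>n. norm (\<Sum>a=m..<n. inner (e a) v *\<^sub>R e a) < \<epsilon>"
    by blast
qed

text \<open>
  The difference of \<open>w\<close> and its expansion is orthogonal to every \<open>e a\<close>, hence to the closed
  linear span, to which it belongs itself.
\<close>

lemma orthonormal_basis_sums:
  fixes e :: "nat \<Rightarrow> 'a::{real_inner, banach}"
  assumes basis: "orthonormal_basis e S" and "w \<in> S"
  shows "(\<lambda>a. inner (e a) w *\<^sub>R e a) sums w"
proof -
  have on: "inner (e a) (e b) = (if a = b then 1 else 0)" for a b
    using basis by (simp add: orthonormal_basis_def)
  define s where "s = (\<Sum>a. inner (e a) w *\<^sub>R e a)"
  have sums: "(\<lambda>a. inner (e a) w *\<^sub>R e a) sums s"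
    unfolding s_def by (rule summable_sums[OF summable_orthonormal_expansion[OF on]])
  have orth: "inner (e a) (w - s) = 0" for a
  proof -
    have "(\<lambda>b. inner (e a) (inner (e b) w *\<^sub>R e b)) sums inner (e a) s"
      using bounded_linear.sums[OF bounded_linear_inner_right sums] .
    moreover have "(\<lambda>b. inner (e a) (inner (e b) w *\<^sub>R e b)) sums inner (e a) w"
    proof -
      have "(\<lambda>b. if b = a then inner (e a) w else 0) sums inner (e a) w"
        by (rule sums_single)
      then show ?thesis
        by (rule sums_cong[THEN iffD1, rotated]) (auto simp: on)
    qed
    ultimately show ?thesis
      using sums_unique2 by (simp add: inner_diff_right) blast
  qed
  have "closure (span (range e)) \<subseteq> {x. inner x (w - s) = 0}"
  proof (rule closure_minimal)
    show "span (range e) \<subseteq> {x. inner x (w - s) = 0}"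
      by (rule span_minimal) (auto simp: orth subspace_def inner_add_left)
    show "closed {x. inner x (w - s) = 0}"
      by (intro closed_Collect_eq continuous_intros)
  qed
  moreover have "w \<in> closure (span (range e))"
    using basis \<open>w \<in> S\<close> by (auto simp: orthonormal_basis_def)
  moreover have "s \<in> closure (span (range e))"
  proof -
    have "(\<Sum>a<n. inner (e a) w *\<^sub>R e a) \<in> span (range e)" for n
      by (intro span_sum span_scale span_base) auto
    then show ?thesis
      unfolding closure_sequential using sums[unfolded sums_def] by (intro exI conjI allI)
  qed
  ultimately have "inner w (w - s) = 0" "inner s (w - s) = 0"
    by blast+
  then have "inner (w - s) (w - s) = 0"
    by (simp add: inner_diff_left)
  then show ?thesis
    using sums by simp
qed

lemma tangential_sums:
  fixes e :: "'h::{real_inner, banach} \<Rightarrow> nat \<Rightarrow> 'h"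
  assumes basis: "orthonormal_basis (e q) S"
  shows "(\<lambda>a. inner (e q a) v *\<^sub>R e q a) sums tangential e q v"
  unfolding tangential_def
  by (rule summable_sums[OF summable_orthonormal_expansion])
    (use basis in \<open>simp add: orthonormal_basis_def\<close>)

text \<open>
  This and the next lemma say that the tangential component is the orthogonal projection onto \<open>S\<close>.
\<close>

lemma tangential_in:
  fixes e :: "'h::{real_inner, banach} \<Rightarrow> nat \<Rightarrow> 'h"
  assumes basis: "orthonormal_basis (e q) S" and "subspace S" "closed S"
  shows "tangential e q v \<in> S"
proof -
  have "(\<Sum>a<n. inner (e q a) v *\<^sub>R e q a) \<in> S" for n
    using basis \<open>subspace S\<close>
    by (intro subspace_sum subspace_scale) (auto simp: orthonormal_basis_def)
  then show ?thesis
    using closed_sequentially[OF \<open>closed S\<close> _ tangential_sums[of e q S, OF basis, of v, unfolded sums_def]]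
    by blast
qed

lemma inner_tangential:
  fixes e :: "'h::{real_inner, banach} \<Rightarrow> nat \<Rightarrow> 'h"
  assumes basis: "orthonormal_basis (e q) S" and "w \<in> S"
  shows "inner (tangential e q v) w = inner v w"
proof -
  have "(\<lambda>a. inner (inner (e q a) v *\<^sub>R e q a) w) sums inner (tangential e q v) w"
    using bounded_linear.sums[OF bounded_linear_inner_left tangential_sums[of e q S, OF basis]] .
  moreover have "(\<lambda>a. inner v (inner (e q a) w *\<^sub>R e q a)) sums inner v w"
    using bounded_linear.sums[OF bounded_linear_inner_right orthonormal_basis_sums[OF basis \<open>w \<in> S\<close>]] .
  then have "(\<lambda>a. inner (inner (e q a) v *\<^sub>R e q a) w) sums inner v w"
    by (simp add: inner_commute mult.commute)
  ultimately show ?thesis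
    by (rule sums_unique2)
qed

section \<open>Injective operators with closed range are bounded below\<close>

text \<open>
  The first half of the open mapping theorem. The range is complete and is the union of its
  intersections with the closures of the images of the balls of radius \<open>n\<close>; by Baire, one of
  these has an interior point. Convexity and symmetry of balls move that point to the origin,
  and homogeneity gives the estimate for all \<open>t\<close>.
\<close>

lemma approx_preimage_of_closed_range:
  fixes L :: "'a::banach \<Rightarrow> 'b::banach"
  assumes L: "bounded_linear L" and cl: "closed (range L)"
  obtains C where "C > 0"
    and "\<And>t \<epsilon>. t \<in> range L \<Longrightarrow> \<epsilon> > 0 \<Longrightarrow> \<exists>x. norm x \<le> C * norm t \<and> norm (t - L x) \<le> \<epsilon>"
proof -
  interpret L: bounded_linear L by fact
  let ?X = "top_of_set (range L)"
  define F where "F n = range L \<inter> closure (L ` cball 0 (real n))" for n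
  have "\<exists>n. ?X interior_of F n \<noteq> {}"
  proof (rule ccontr)
    assume "\<nexists>n. ?X interior_of F n \<noteq> {}"
    then have "?X interior_of \<Union>(range F) = {}"
      using cl
      by (intro Baire_category_alt disjI1 completely_metrizable_space_closedin
           [OF completely_metrizable_space_euclidean])
         (auto simp: F_def closedin_closed)
    moreover have "\<Union>(range F) = range L"
    proof (intro equalityI subsetI)
      fix y assume "y \<in> range L"
      then obtain x where x: "y = L x" by auto
      obtain n where "norm x \<le> real n" using real_arch_simple by blast
      then have "y \<in> F n"
        unfolding F_def x using closure_subset[of "L ` cball 0 (real n)"] by auto
      then show "y \<in> \<Union>(range F)" by auto
    qed (auto simp: F_def)
    ultimately show False
      by (metis UNIV_not_empty image_is_empty interior_of_topspace topspace_euclidean_subtopology)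
  qed
  then obtain n y where "y \<in> ?X interior_of F n" by blast
  then obtain U where "openin ?X U" "y \<in> U" and UF: "U \<subseteq> F n"
    by (auto simp: interior_of_def)
  then obtain r where "r > 0" and yr: "y \<in> range L" and r: "ball y r \<inter> range L \<subseteq> F n"
    unfolding openin_contains_ball by (metis subsetD order_trans)
  \<comment> \<open>\<open>t\<close> is the midpoint of \<open>y + t\<close> and \<open>- (y - t)\<close>\<close>
  have small: "t \<in> closure (L ` cball 0 (real n))" if t: "t \<in> range L" "norm t < r" for t
  proof -
    have "y + t \<in> range L" "y - t \<in> range L"
      using yr t by (auto simp flip: L.add L.diff)
    then have "y + t \<in> F n" "y - t \<in> F n"
      using r t by (auto simp: dist_norm subset_iff)
    then have "y + t \<in> closure (L ` cball 0 (real n))" "y - t \<in> closure (L ` cball 0 (real n))"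
      by (auto simp: F_def)
    moreover have cv: "convex (closure (L ` cball 0 (real n)))"
      by (intro convex_closure convex_linear_image L.linear convex_cball)
    moreover have "- (y - t) \<in> closure (L ` cball 0 (real n))"
    proof -
      have "uminus ` closure (L ` cball 0 (real n)) = closure (uminus ` L ` cball 0 (real n))"
        using closure_scaleR[of "-1" "L ` cball 0 (real n)"] by (simp add: image_image scaleR_minus1_left)
      moreover have "uminus ` L ` cball 0 (real n) = L ` cball 0 (real n)"
      proof -
        have "uminus ` L ` cball 0 (real n) = L ` uminus ` cball 0 (real n)"
          by (simp add: image_image L.neg)
        also have "uminus ` cball 0 (real n) = cball (0::'a) (real n)"
          by (auto simp: image_iff intro!: bexI[of _ "- _"])
        finally show ?thesis .
      qed
      ultimately show ?thesis using \<open>y - t \<in> closure _\<close> by (metis imageI)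
    qed
    ultimately have "(1/2) *\<^sub>R (y + t) + (1/2) *\<^sub>R (- (y - t)) \<in> closure (L ` cball 0 (real n))"
      by (intro convexD) auto
    moreover have "(1/2) *\<^sub>R (y + t) + (1/2) *\<^sub>R (- (y - t)) = (1/2) *\<^sub>R t + (1/2) *\<^sub>R t"
      by (simp add: algebra_simps)
    ultimately show ?thesis
      by (simp flip: scaleR_add_left)
  qed
  show thesis
  proof
    show "2 * (real n + 1) / r > 0" using \<open>r > 0\<close> by simp
    fix t and \<epsilon> :: real
    assume t: "t \<in> range L" and "\<epsilon> > 0"
    show "\<exists>x. norm x \<le> 2 * (real n + 1) / r * norm t \<and> norm (t - L x) \<le> \<epsilon>"
    proof (cases "t = 0")
      case True
      then show ?thesis using \<open>\<epsilon> > 0\<close> by (intro exI[of _ 0]) (simp add: L.zero)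
    next
      case False
      define k where "k = r / (2 * norm t)"
      have "k > 0" using \<open>r > 0\<close> False by (simp add: k_def)
      have "k *\<^sub>R t \<in> range L"
        using t by (auto simp flip: L.scaleR)
      moreover have "norm (k *\<^sub>R t) < r"
        using \<open>r > 0\<close> False by (simp add: k_def)
      ultimately have "k *\<^sub>R t \<in> closure (L ` cball 0 (real n))"
        by (rule small)
      then obtain x where x: "norm x \<le> real n" and d: "dist (L x) (k *\<^sub>R t) < k * \<epsilon>"
        unfolding closure_approachable using mult_pos_pos[OF \<open>k > 0\<close> \<open>\<epsilon> > 0\<close>]
        by (metis (no_types, lifting) imageE mem_cball_0)
      have "norm (x /\<^sub>R k) \<le> 2 * (real n + 1) / r * norm t"
      proof -
        have "norm (x /\<^sub>R k) = norm x / k" using \<open>k > 0\<close> by (simp add: field_simps)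
        also have "\<dots> \<le> (real n + 1) / k"
          using x \<open>k > 0\<close> by (intro divide_right_mono) auto
        also have "\<dots> = 2 * (real n + 1) / r * norm t" using False by (simp add: k_def field_simps)
        finally show ?thesis .
      qed
      moreover have "norm (t - L (x /\<^sub>R k)) \<le> \<epsilon>"
      proof -
        have "t - L (x /\<^sub>R k) = (k *\<^sub>R t - L x) /\<^sub>R k"
          using \<open>k > 0\<close> by (simp add: L.scaleR algebra_simps)
        then have "norm (t - L (x /\<^sub>R k)) = dist (L x) (k *\<^sub>R t) / k"
          by (simp only: dist_norm norm_minus_commute[of "L x"] norm_scaleR)
            (use \<open>k > 0\<close> in \<open>simp add: field_simps\<close>)
        also have "\<dots> \<le> \<epsilon>" using d \<open>k > 0\<close> by (simp add: field_simps)
        finally show ?thesis .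
      qed
      ultimately show ?thesis by blast
    qed
  qed
qed

text \<open>
  The second half of the open mapping theorem: approximate preimages with errors decreasing
  geometrically are summed up to a preimage \<open>z\<close> of \<open>L x\<close> of norm at most \<open>2 * C * norm (L x)\<close>, and
  \<open>z = x\<close> by injectivity.
\<close>

lemma bounded_below_of_closed_range:
  fixes L :: "'a::banach \<Rightarrow> 'b::banach"
  assumes L: "bounded_linear L" and cl: "closed (range L)" and inj: "inj L"
  obtains C where "C > 0" "\<And>x. norm x \<le> C * norm (L x)"
proof -
  interpret L: bounded_linear L by fact
  obtain C where "C > 0"
    and C: "\<And>t \<epsilon>. t \<in> range L \<Longrightarrow> \<epsilon> > 0 \<Longrightarrow> \<exists>x. norm x \<le> C * norm t \<and> norm (t - L x) \<le> \<epsilon>"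
    using approx_preimage_of_closed_range[OF L cl] by blast
  have "norm x \<le> 2 * C * norm (L x)" for x
  proof (cases "L x = 0")
    case True
    then have "x = 0" using inj L.zero by (metis injD)
    then show ?thesis by (simp add: L.zero)
  next
    case False
    define N where "N = norm (L x)"
    have "N > 0" using False by (simp add: N_def)
    have "\<exists>z. norm z \<le> C * norm u \<and> norm (u - L z) \<le> N * (1/2)^Suc k" if "u \<in> range L" for u k
      by (rule C[OF that]) (use \<open>N > 0\<close> in simp)
    then obtain Z where Z: "\<And>u k. u \<in> range L \<Longrightarrow>
        norm (Z u k) \<le> C * norm u \<and> norm (u - L (Z u k)) \<le> N * (1/2)^Suc k"
      by metis
    \<comment> \<open>\<open>t k\<close> is the part of \<open>L x\<close> that remains after \<open>k\<close> corrections\<close>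
    define t where "t = rec_nat (L x) (\<lambda>k u. u - L (Z u k))"
    have t0: "t 0 = L x" and tS: "t (Suc k) = t k - L (Z (t k) k)" for k
      by (simp_all add: t_def)
    have tr: "t k \<in> range L" for k
      by (induction k) (auto simp: t0 tS simp flip: L.diff)
    have tb: "norm (t k) \<le> N * (1/2)^k" for k
      using Z[OF tr] by (cases k) (auto simp: t0 tS N_def)
    have zb: "norm (Z (t k) k) \<le> (C * N) * (1/2)^k" for k
      using Z[OF tr[of k], of k] mult_left_mono[OF tb[of k], of C] \<open>C > 0\<close>
      unfolding mult.assoc by linarith
    have geo: "(\<lambda>k. (C * N) * (1/2::real)^k) sums (C * N * 2)"
      using sums_mult[OF geometric_sums[of "1/2::real"], of "C * N"] by simp
    have sm: "summable (\<lambda>k. norm (Z (t k) k))"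
      by (rule summable_comparison_test[OF _ sums_summable[OF geo]]) (use zb in auto)
    define z where "z = (\<Sum>k. Z (t k) k)"
    have "(\<lambda>k. L (Z (t k) k)) sums L z"
      unfolding z_def by (rule L.sums[OF summable_sums[OF summable_norm_cancel[OF sm]]])
    moreover have "(\<lambda>k. L (Z (t k) k)) sums L x"
    proof -
      have eq: "(\<Sum>k<m. L (Z (t k) k)) = L x - t m" for m
        by (induction m) (auto simp: t0 tS algebra_simps)
      have "(\<lambda>m. N * (1/2::real)^m) \<longlonglongrightarrow> 0"
        by (intro tendsto_mult_right_zero LIMSEQ_power_zero) auto
      then have "t \<longlonglongrightarrow> 0"
        by (rule Lim_null_comparison[rotated]) (use tb in auto)
      then have "(\<lambda>m. L x - t m) \<longlonglongrightarrow> L x - 0"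
        by (intro tendsto_intros)
      then show ?thesis by (simp add: sums_def eq)
    qed
    ultimately have "L z = L x" by (rule sums_unique2)
    then have "z = x" using inj by (simp add: inj_eq)
    have "norm z \<le> (\<Sum>k. norm (Z (t k) k))"
      unfolding z_def by (rule summable_norm[OF sm])
    also have "\<dots> \<le> C * N * 2"
      using suminf_le[OF zb sm sums_summable[OF geo]] sums_unique[OF geo] by simp
    finally show ?thesis using \<open>z = x\<close> by (simp add: N_def mult_ac)
  qed
  with \<open>C > 0\<close> show thesis by (intro that[of "2 * C"]) auto
qed

section \<open>Moments of sums and the weak law of large numbers\<close>

lemma (in prob_space) indep_vars_imp_indep_var:
  assumes "indep_vars (\<lambda>_. N) Y UNIV" and "i \<noteq> k"
  shows "indep_var N (Y i) N (Y k)"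
proof -
  have "indep_var
      N ((\<lambda>f. f i) \<circ> (\<lambda>\<omega>. restrict (\<lambda>i. Y i \<omega>) {i}))
      N ((\<lambda>f. f k) \<circ> (\<lambda>\<omega>. restrict (\<lambda>i. Y i \<omega>) {k}))"
    using assms by (intro indep_var_compose[OF indep_var_restrict[OF assms(1)]]) auto
  then show ?thesis
    by (simp add: comp_def)
qed

lemma (in prob_space) integrable_inner_of_square_integrable:
  fixes Y Z :: "'a \<Rightarrow> 'h::{real_inner, banach, second_countable_topology}"
  assumes [measurable]: "random_variable borel Y" "random_variable borel Z"
    and "integrable M (\<lambda>\<omega>. (norm (Y \<omega>))\<^sup>2)" "integrable M (\<lambda>\<omega>. (norm (Z \<omega>))\<^sup>2)"
  shows "integrable M (\<lambda>\<omega>. inner (Y \<omega>) (Z \<omega>))"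
proof (rule Bochner_Integration.integrable_bound)
  show "integrable M (\<lambda>\<omega>. (norm (Y \<omega>))\<^sup>2 + (norm (Z \<omega>))\<^sup>2)"
    using assms by simp
  have "\<bar>inner u v\<bar> \<le> (norm u)\<^sup>2 + (norm v)\<^sup>2" for u v :: 'h
    using Cauchy_Schwarz_ineq2[of u v] sum_squares_bound[of "norm u" "norm v"]
      mult_nonneg_nonneg[OF norm_ge_zero[of u] norm_ge_zero[of v]] by linarith
  then show "AE \<omega> in M. norm (inner (Y \<omega>) (Z \<omega>)) \<le> norm ((norm (Y \<omega>))\<^sup>2 + (norm (Z \<omega>))\<^sup>2)"
    by simp
qed simp

lemma (in prob_space) integrable_of_square_integrable:
  fixes Y :: "'a \<Rightarrow> 'h::{real_inner, banach, second_countable_topology}"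
  assumes "random_variable borel Y" "integrable M (\<lambda>\<omega>. (norm (Y \<omega>))\<^sup>2)"
  shows "integrable M Y"
proof (rule integrable_norm_cancel)
  show "integrable M (\<lambda>\<omega>. norm (Y \<omega>))"
    by (rule square_integrable_imp_integrable[OF _ assms(2)]) (use assms(1) in measurable)
qed (rule assms(1))

lemma (in prob_space) square_integrable_centered:
  fixes Y :: "'a \<Rightarrow> 'h::{real_inner, banach, second_countable_topology}"
  assumes [measurable]: "random_variable borel Y" and Y2: "integrable M (\<lambda>\<omega>. (norm (Y \<omega>))\<^sup>2)"
  shows "integrable M (\<lambda>\<omega>. (norm (Y \<omega> - c))\<^sup>2)"
proof (rule Bochner_Integration.integrable_bound)
  show "integrable M (\<lambda>\<omega>. 2 * (norm (Y \<omega>))\<^sup>2 + 2 * (norm c)\<^sup>2)"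
    using Y2 by simp
  have "(norm (u - c))\<^sup>2 \<le> 2 * (norm u)\<^sup>2 + 2 * (norm c)\<^sup>2" for u
  proof -
    have "(norm (u - c))\<^sup>2 \<le> (norm u + norm c)\<^sup>2"
      by (intro power_mono norm_triangle_ineq4) simp
    also have "\<dots> \<le> 2 * (norm u)\<^sup>2 + 2 * (norm c)\<^sup>2"
      using sum_squares_bound[of "norm u" "norm c"] by (simp add: power2_sum)
    finally show ?thesis .
  qed
  then show "AE \<omega> in M. norm ((norm (Y \<omega> - c))\<^sup>2) \<le> norm (2 * (norm (Y \<omega>))\<^sup>2 + 2 * (norm c)\<^sup>2)"
    by simp
qed measurable

text \<open>
  The joint distribution is the product of the marginals, so Fubini reduces this to linearity
  of the Bochner integral in each argument.
\<close>

lemma (in prob_space) expectation_inner_indep: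
  fixes Y Z :: "'a \<Rightarrow> 'h::{real_inner, banach, second_countable_topology}"
  assumes indep: "indep_var borel Y borel Z"
    and Y2: "integrable M (\<lambda>\<omega>. (norm (Y \<omega>))\<^sup>2)" and Z2: "integrable M (\<lambda>\<omega>. (norm (Z \<omega>))\<^sup>2)"
  shows "expectation (\<lambda>\<omega>. inner (Y \<omega>) (Z \<omega>)) = inner (expectation Y) (expectation Z)"
proof -
  have rv[measurable]: "random_variable borel Y" "random_variable borel Z"
    using indep_var_rv1[OF indep] indep_var_rv2[OF indep] .
  note int = integrable_of_square_integrable[OF rv(1) Y2] integrable_of_square_integrable[OF rv(2) Z2]
  let ?P = "distr M borel Y" and ?Q = "distr M borel Z"
  interpret P: prob_space ?P by (rule prob_space_distr) simp
  interpret Q: prob_space ?Q by (rule prob_space_distr) simp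
  interpret PQ: pair_sigma_finite ?P ?Q ..
  have prod: "?P \<Otimes>\<^sub>M ?Q = distr M (borel \<Otimes>\<^sub>M borel) (\<lambda>\<omega>. (Y \<omega>, Z \<omega>))"
    using indep by (simp add: indep_var_distribution_eq)
  have meas: "(\<lambda>(y, z). inner y z :: real) \<in> borel_measurable (borel \<Otimes>\<^sub>M (borel :: 'h measure))"
    by measurable
  have "integrable (?P \<Otimes>\<^sub>M ?Q) (\<lambda>(y, z). inner y z)"
    unfolding prod
    by (subst integrable_distr_eq[OF _ meas])
      (auto intro: integrable_inner_of_square_integrable Y2 Z2)
  from PQ.integral_fst'[OF this]
  have "(\<integral>y. \<integral>z. inner y z \<partial>?Q \<partial>?P) = integral\<^sup>L (?P \<Otimes>\<^sub>M ?Q) (\<lambda>(y, z). inner y z)"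
    by simp
  also have "\<dots> = expectation (\<lambda>\<omega>. inner (Y \<omega>) (Z \<omega>))"
    unfolding prod by (subst integral_distr[OF _ meas]) auto
  finally have eq: "expectation (\<lambda>\<omega>. inner (Y \<omega>) (Z \<omega>)) = (\<integral>y. \<integral>z. inner y z \<partial>?Q \<partial>?P)"
    by simp
  have "(\<integral>z. inner y z \<partial>?Q) = inner y (expectation Z)" for y
    by (subst integral_distr[OF rv(2)], measurable) (rule integral_inner_right, rule int)
  then have "(\<integral>y. \<integral>z. inner y z \<partial>?Q \<partial>?P) = (\<integral>y. inner y (expectation Z) \<partial>?P)"
    by (simp only:)
  also have "\<dots> = inner (expectation Y) (expectation Z)"
    by (subst integral_distr[OF rv(1)], measurable) (rule integral_inner_left, rule int)
  finally show ?thesis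
    unfolding eq .
qed

text \<open>
  Pythagoras: independent centred vectors are orthogonal in \<open>L\<^sup>2\<close>.
\<close>

lemma (in prob_space) second_moment_sum_indep:
  fixes Y :: "nat \<Rightarrow> 'a \<Rightarrow> 'h::{real_inner, banach, second_countable_topology}"
  assumes indep: "indep_vars (\<lambda>_. borel) Y UNIV"
    and mean0: "\<And>i. expectation (Y i) = 0"
    and int2: "\<And>i. integrable M (\<lambda>\<omega>. (norm (Y i \<omega>))\<^sup>2)"
    and moment: "\<And>i. expectation (\<lambda>\<omega>. (norm (Y i \<omega>))\<^sup>2) = V"
  shows "integrable M (\<lambda>\<omega>. (norm (\<Sum>i<n. Y i \<omega>))\<^sup>2)" (is ?int)
    and "expectation (\<lambda>\<omega>. (norm (\<Sum>i<n. Y i \<omega>))\<^sup>2) = real n * V" (is ?eq)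
proof -
  have rv[measurable]: "random_variable borel (Y i)" for i
    using indep by (simp add: indep_vars_def)
  have int: "integrable M (\<lambda>\<omega>. inner (Y i \<omega>) (Y k \<omega>))" for i k
    by (intro integrable_inner_of_square_integrable rv int2)
  have E: "expectation (\<lambda>\<omega>. inner (Y i \<omega>) (Y k \<omega>)) = (if i = k then V else 0)" for i k
    using expectation_inner_indep[OF indep_vars_imp_indep_var[OF indep, of i k] int2 int2]
    by (cases "i = k") (simp_all add: mean0 moment flip: power2_norm_eq_inner)
  have expand: "(norm (\<Sum>i<n. Y i \<omega>))\<^sup>2 = (\<Sum>i<n. \<Sum>k<n. inner (Y i \<omega>) (Y k \<omega>))" for \<omega>
    by (subst sum.swap) (simp add: power2_norm_eq_inner inner_sum_left inner_sum_right)
  show ?int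
    unfolding expand by (intro Bochner_Integration.integrable_sum int)
  have "expectation (\<lambda>\<omega>. (norm (\<Sum>i<n. Y i \<omega>))\<^sup>2)
      = (\<Sum>i<n. \<Sum>k<n. expectation (\<lambda>\<omega>. inner (Y i \<omega>) (Y k \<omega>)))"
    unfolding expand by (simp add: Bochner_Integration.integral_sum Bochner_Integration.integrable_sum int)
  also have "\<dots> = real n * V"
    by (simp add: E)
  finally show ?eq .
qed

lemma (in prob_space) identically_distributed_expectation:
  fixes g :: "'b::topological_space \<Rightarrow> 'c::{banach, second_countable_topology}"
  assumes [measurable]: "random_variable borel Y" "random_variable borel Z" "g \<in> borel_measurable borel"
    and "distr M borel Y = distr M borel Z"
  shows "integrable M (\<lambda>\<omega>. g (Y \<omega>)) \<longleftrightarrow> integrable M (\<lambda>\<omega>. g (Z \<omega>))"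
    and "expectation (\<lambda>\<omega>. g (Y \<omega>)) = expectation (\<lambda>\<omega>. g (Z \<omega>))"
proof -
  show "integrable M (\<lambda>\<omega>. g (Y \<omega>)) \<longleftrightarrow> integrable M (\<lambda>\<omega>. g (Z \<omega>))"
    using integrable_distr_eq[OF assms(1,3)] integrable_distr_eq[OF assms(2,3)] assms(4) by metis
  show "expectation (\<lambda>\<omega>. g (Y \<omega>)) = expectation (\<lambda>\<omega>. g (Z \<omega>))"
    using integral_distr[OF assms(1,3)] integral_distr[OF assms(2,3)] assms(4) by metis
qed

text \<open>
  Only first moments are available, since the law is applied to squares of variables with finite
  second moments. The variables are therefore truncated at a level \<open>k\<close>: the truncated ones have
  bounded variance, so their average is close to its expectation, and the truncation error is
  small in \<open>L\<^sup>1\<close>, uniformly in the number of summands. Markov's inequality turns this convergence in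
  \<open>L\<^sup>1\<close> into convergence in probability.
\<close>

lemma (in prob_space) weak_law_of_large_numbers:
  fixes W :: "nat \<Rightarrow> 'a \<Rightarrow> real"
  assumes indep: "indep_vars (\<lambda>_. borel) W UNIV"
    and ident: "\<And>i. distr M borel (W i) = distr M borel (W 0)"
    and int0: "integrable M (W 0)"
    and "\<eta> > 0"
  shows "(\<lambda>n. prob {\<omega>\<in>space M. \<eta> \<le> \<bar>(\<Sum>i<n. W i \<omega>) / real n - expectation (W 0)\<bar>}) \<longlonglongrightarrow> 0"
proof -
  have rv[measurable]: "random_variable borel (W i)" for i
    using indep by (simp add: indep_vars_def)
  define m where "m = expectation (W 0)"
  define \<phi> where "\<phi> K x = (if \<bar>x\<bar> \<le> K then x else 0)" for K x :: real
  have [measurable]: "\<phi> K \<in> borel_measurable borel" for K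
    unfolding \<phi>_def by measurable
  have \<phi>_le': "\<bar>\<phi> K x\<bar> \<le> \<bar>K\<bar>" for K x
    by (simp add: \<phi>_def)
  have tail: "(\<lambda>k. expectation (\<lambda>\<omega>. \<bar>W 0 \<omega> - \<phi> (real k) (W 0 \<omega>)\<bar>)) \<longlonglongrightarrow> expectation (\<lambda>\<omega>. 0)"
  proof (rule integral_dominated_convergence[where w = "\<lambda>\<omega>. 2 * \<bar>W 0 \<omega>\<bar>"])
    show "AE \<omega> in M. (\<lambda>k. \<bar>W 0 \<omega> - \<phi> (real k) (W 0 \<omega>)\<bar>) \<longlonglongrightarrow> 0"
    proof (rule AE_I2)
      fix \<omega>
      obtain N where N: "\<bar>W 0 \<omega>\<bar> \<le> real N" using real_arch_simple by blast
      have "\<forall>\<^sub>F k in sequentially. \<bar>W 0 \<omega> - \<phi> (real k) (W 0 \<omega>)\<bar> = 0"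
        using eventually_ge_at_top[of N] by eventually_elim (use N in \<open>auto simp: \<phi>_def\<close>)
      then show "(\<lambda>k. \<bar>W 0 \<omega> - \<phi> (real k) (W 0 \<omega>)\<bar>) \<longlonglongrightarrow> 0"
        by (rule tendsto_eventually)
    qed
    show "AE \<omega> in M. norm \<bar>W 0 \<omega> - \<phi> (real k) (W 0 \<omega>)\<bar> \<le> 2 * \<bar>W 0 \<omega>\<bar>" for k
      by (intro AE_I2) (simp add: \<phi>_def)
    show "integrable M (\<lambda>\<omega>. 2 * \<bar>W 0 \<omega>\<bar>)"
      using int0 by simp
  qed measurable
  have small: "\<forall>\<^sub>F n in sequentially.
      expectation (\<lambda>\<omega>. \<bar>(\<Sum>i<n. W i \<omega>) / real n - m\<bar>) \<le> 4 * \<epsilon>" if "\<epsilon> > 0" for \<epsilon>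
  proof -
    obtain k where k: "expectation (\<lambda>\<omega>. \<bar>W 0 \<omega> - \<phi> (real k) (W 0 \<omega>)\<bar>) < \<epsilon>"
      using order_tendstoD(2)[OF tail, of \<epsilon>] \<open>\<epsilon> > 0\<close> by (auto simp: eventually_sequentially)
    define f where "f = \<phi> (real k)"
    have [measurable]: "f \<in> borel_measurable borel" by (simp add: f_def)
    have f_le: "\<bar>f x\<bar> \<le> real k" for x using \<phi>_le'[of "real k" x] by (simp add: f_def)
    have intf: "integrable M (\<lambda>\<omega>. f (W i \<omega>))" for i
      by (rule integrable_const_bound[of _ "real k"]) (auto simp: f_le)
    have intW: "integrable M (W i)" for i
      using identically_distributed_expectation(1)[OF rv rv _ ident, of "\<lambda>x. x" i] int0 by simp
    define mf where "mf = expectation (\<lambda>\<omega>. f (W 0 \<omega>))"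
    define B where "B i \<omega> = f (W i \<omega>) - mf" for i \<omega>
    define V where "V = expectation (\<lambda>\<omega>. (norm (B 0 \<omega>))\<^sup>2)"
    have [measurable]: "random_variable borel (B i)" for i
      unfolding B_def by measurable
    have Ef: "expectation (\<lambda>\<omega>. g (W i \<omega>)) = expectation (\<lambda>\<omega>. g (W 0 \<omega>))"
      if "g \<in> borel_measurable borel" for i and g :: "real \<Rightarrow> real"
      by (intro identically_distributed_expectation(2)[OF rv rv that ident])
    have indepB: "indep_vars (\<lambda>_. borel) B UNIV"
      unfolding B_def[abs_def] by (rule indep_vars_compose2[OF indep]) simp
    have B0: "expectation (B i) = 0" for i
      using Ef[of f i] intf by (simp add: B_def[abs_def] prob_space mf_def)
    have intB2: "integrable M (\<lambda>\<omega>. (norm (B i \<omega>))\<^sup>2)" for i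
    proof (rule integrable_const_bound[of _ "(real k + \<bar>mf\<bar>)\<^sup>2"])
      have "\<bar>B i \<omega>\<bar> \<le> real k + \<bar>mf\<bar>" for \<omega>
        using f_le[of "W i \<omega>"] by (simp add: B_def)
      then show "AE \<omega> in M. norm ((norm (B i \<omega>))\<^sup>2) \<le> (real k + \<bar>mf\<bar>)\<^sup>2"
        by (simp flip: abs_le_square_iff add: power_mono)
    qed simp
    have BV: "expectation (\<lambda>\<omega>. (norm (B i \<omega>))\<^sup>2) = V" for i
      unfolding V_def B_def by (rule Ef) simp
    note mom = second_moment_sum_indep[OF indepB B0 intB2 BV]
    have bound: "expectation (\<lambda>\<omega>. \<bar>(\<Sum>i<n. W i \<omega>) / real n - m\<bar>) \<le> 3 * \<epsilon> + V / (\<epsilon> * real n)"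
      if "n > 0" for n
    proof -
      let ?A = "\<lambda>\<omega>. (\<Sum>i<n. B i \<omega>) / real n"
      let ?R = "\<lambda>i \<omega>. \<bar>W i \<omega> - f (W i \<omega>)\<bar>"
      have R: "expectation (?R i) < \<epsilon>" for i
        using Ef[of "\<lambda>x. \<bar>x - f x\<bar>" i] k by (simp add: f_def)
      have "\<bar>m - mf\<bar> = \<bar>expectation (\<lambda>\<omega>. W 0 \<omega> - f (W 0 \<omega>))\<bar>"
        by (simp add: m_def mf_def intW intf)
      also have "\<dots> \<le> expectation (?R 0)"
        by (rule integral_abs_bound)
      finally have mm: "\<bar>m - mf\<bar> \<le> \<epsilon>" using R[of 0] by simp
      have pt: "\<bar>(\<Sum>i<n. W i \<omega>) / real n - m\<bar>
          \<le> (\<epsilon> + (norm (\<Sum>i<n. B i \<omega>))\<^sup>2 / (real n)\<^sup>2 / \<epsilon>) + (\<Sum>i<n. ?R i \<omega>) / real n + \<epsilon>" for \<omega>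
      proof -
        have "(\<Sum>i<n. W i \<omega>) / real n - m = ?A \<omega> + (\<Sum>i<n. W i \<omega> - f (W i \<omega>)) / real n + (mf - m)"
          using \<open>n > 0\<close> by (simp add: B_def sum_subtractf field_simps)
        moreover have "\<bar>(\<Sum>i<n. W i \<omega> - f (W i \<omega>)) / real n\<bar> \<le> (\<Sum>i<n. ?R i \<omega>) / real n"
          by (simp add: divide_right_mono sum_abs)
        moreover have "\<bar>?A \<omega>\<bar> \<le> \<epsilon> + (?A \<omega>)\<^sup>2 / \<epsilon>"
        proof -
          have young: "\<bar>a\<bar> \<le> \<epsilon> + a\<^sup>2 / \<epsilon>" for a
          proof -
            have "2 * \<epsilon> * \<bar>a\<bar> \<le> \<epsilon>\<^sup>2 + a\<^sup>2"
              using sum_squares_bound[of \<epsilon> "\<bar>a\<bar>"] by simp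
            moreover have "0 \<le> \<epsilon> * \<bar>a\<bar>" using \<open>\<epsilon> > 0\<close> by simp
            ultimately have "\<epsilon> * \<bar>a\<bar> \<le> \<epsilon>\<^sup>2 + a\<^sup>2"
              by linarith
            also have "\<dots> = \<epsilon> * (\<epsilon> + a\<^sup>2 / \<epsilon>)"
              using \<open>\<epsilon> > 0\<close> by (simp add: distrib_left power2_eq_square)
            finally show ?thesis using \<open>\<epsilon> > 0\<close> by simp
          qed
          show ?thesis by (rule young)
        qed
        moreover have "(?A \<omega>)\<^sup>2 / \<epsilon> = (norm (\<Sum>i<n. B i \<omega>))\<^sup>2 / (real n)\<^sup>2 / \<epsilon>"
          by (simp add: power_divide)
        ultimately show ?thesis using mm by linarith
      qed
      have "expectation (\<lambda>\<omega>. \<bar>(\<Sum>i<n. W i \<omega>) / real n - m\<bar>)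
          \<le> expectation (\<lambda>\<omega>. (\<epsilon> + (norm (\<Sum>i<n. B i \<omega>))\<^sup>2 / (real n)\<^sup>2 / \<epsilon>) + (\<Sum>i<n. ?R i \<omega>) / real n + \<epsilon>)"
        by (intro integral_mono pt mom(1) intW intf integrable_abs integrable_const
            Bochner_Integration.integrable_add Bochner_Integration.integrable_diff
            Bochner_Integration.integrable_sum integrable_divide_zero)
      also have "\<dots> = \<epsilon> + real n * V / (real n)\<^sup>2 / \<epsilon> + (\<Sum>i<n. expectation (?R i)) / real n + \<epsilon>"
        using mom[of n] by (simp add: intW intf prob_space del: real_norm_def)
      also have "(\<Sum>i<n. expectation (?R i)) / real n \<le> (\<Sum>i<n. \<epsilon>) / real n"
        by (intro divide_right_mono sum_mono less_imp_le[OF R]) simp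
      also have "(\<Sum>i<n. \<epsilon>) / real n = \<epsilon>" using \<open>n > 0\<close> by simp
      also have "real n * V / (real n)\<^sup>2 / \<epsilon> = V / (\<epsilon> * real n)"
        using \<open>n > 0\<close> by (simp add: power2_eq_square)
      finally show ?thesis by simp
    qed
    have "(\<lambda>n. V / \<epsilon> / real n) \<longlonglongrightarrow> 0" by (rule lim_const_over_n)
    then have "\<forall>\<^sub>F n in sequentially. V / \<epsilon> / real n < \<epsilon>"
      using \<open>\<epsilon> > 0\<close> by (rule order_tendstoD)
    then show ?thesis
      using eventually_gt_at_top[of 0]
    proof eventually_elim
      case (elim n)
      with bound[of n] show ?case by simp
    qed
  qed
  have intW: "integrable M (W i)" for i
    using identically_distributed_expectation(1)[OF rv rv _ ident, of "\<lambda>x. x" i] int0 by simp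
  show ?thesis
    unfolding m_def[symmetric]
  proof (rule tendstoI)
    fix \<tau> :: real assume "\<tau> > 0"
    have "\<forall>\<^sub>F n in sequentially. expectation (\<lambda>\<omega>. \<bar>(\<Sum>i<n. W i \<omega>) / real n - m\<bar>) \<le> 4 * (\<eta> * \<tau> / 8)"
      by (rule small) (use \<open>\<eta> > 0\<close> \<open>\<tau> > 0\<close> in simp)
    then show "\<forall>\<^sub>F n in sequentially.
        dist (prob {\<omega>\<in>space M. \<eta> \<le> \<bar>(\<Sum>i<n. W i \<omega>) / real n - m\<bar>}) 0 < \<tau>"
    proof eventually_elim
      case (elim n)
      have "prob {\<omega>\<in>space M. \<eta> \<le> \<bar>(\<Sum>i<n. W i \<omega>) / real n - m\<bar>}
          \<le> expectation (\<lambda>\<omega>. \<bar>(\<Sum>i<n. W i \<omega>) / real n - m\<bar>) / \<eta>"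
        by (rule integral_Markov_inequality_measure[where A = "{}"]) (use intW \<open>\<eta> > 0\<close> in auto)
      also have "\<dots> \<le> 4 * (\<eta> * \<tau> / 8) / \<eta>"
        using elim \<open>\<eta> > 0\<close> by (intro divide_right_mono) auto
      also have "\<dots> < \<tau>" using \<open>\<eta> > 0\<close> \<open>\<tau> > 0\<close> by simp
      finally show ?case by simp
    qed
  qed
qed

section \<open>Slutsky's lemma\<close>

lemma norm_iexp_diff_le: "cmod (iexp x - iexp y) \<le> \<bar>x - y\<bar>" "cmod (iexp x - iexp y) \<le> 2"
proof -
  have "iexp x - iexp y = iexp y * (iexp (x - y) - 1)"
    by (simp add: right_diff_distrib flip: exp_add add: algebra_simps)
  then have "cmod (iexp x - iexp y) = cmod (iexp (x - y) - 1)"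
    by (simp add: norm_mult)
  then show "cmod (iexp x - iexp y) \<le> \<bar>x - y\<bar>"
    using iexp_approx1[of "x - y" 0] by simp
  show "cmod (iexp x - iexp y) \<le> 2"
    using norm_triangle_ineq4[of "iexp x" "iexp y"] by simp
qed

text \<open>
  By Levy's continuity theorem it suffices to compare characteristic functions, and
  \<open>s \<mapsto> exp (i t s)\<close> is bounded and Lipschitz continuous.
\<close>

lemma (in prob_space) slutsky:
  fixes S T :: "nat \<Rightarrow> 'a \<Rightarrow> real"
  assumes S[measurable]: "\<And>n. random_variable borel (S n)"
    and T[measurable]: "\<And>n. random_variable borel (T n)"
    and N: "real_distribution N"
    and conv: "weak_conv_m (\<lambda>n. distr M borel (S n)) N"
    and diff: "\<And>\<eta>. \<eta> > 0 \<Longrightarrow> (\<lambda>n. prob {\<omega>\<in>space M. \<eta> \<le> \<bar>T n \<omega> - S n \<omega>\<bar>}) \<longlonglongrightarrow> 0"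
  shows "weak_conv_m (\<lambda>n. distr M borel (T n)) N"
proof (rule levy_continuity)
  show "real_distribution (distr M borel (T n))" for n
    by (rule real_distribution_distr) simp
  show "real_distribution N" by fact
  fix t :: real
  have S_char: "(\<lambda>n. char (distr M borel (S n)) t) \<longlonglongrightarrow> char N t"
    by (rule levy_continuity1[OF _ N conv]) (rule real_distribution_distr, simp)
  have "(\<lambda>n. char (distr M borel (T n)) t - char (distr M borel (S n)) t) \<longlonglongrightarrow> 0"
  proof (rule tendstoI)
    fix \<epsilon> :: real assume "\<epsilon> > 0"
    define \<eta> where "\<eta> = \<epsilon> / (4 * (\<bar>t\<bar> + 1))"
    have "\<eta> > 0" using \<open>\<epsilon> > 0\<close> by (simp add: \<eta>_def)
    have t\<eta>: "\<bar>t\<bar> * \<eta> \<le> \<epsilon> / 4"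
      using \<open>\<epsilon> > 0\<close> by (simp add: \<eta>_def field_simps)
    have "\<forall>\<^sub>F n in sequentially. prob {\<omega>\<in>space M. \<eta> \<le> \<bar>T n \<omega> - S n \<omega>\<bar>} < \<epsilon> / 4"
      using diff[OF \<open>\<eta> > 0\<close>] \<open>\<epsilon> > 0\<close> by (intro order_tendstoD) auto
    then show "\<forall>\<^sub>F n in sequentially.
        dist (char (distr M borel (T n)) t - char (distr M borel (S n)) t) 0 < \<epsilon>"
    proof eventually_elim
      case (elim n)
      let ?E = "{\<omega>\<in>space M. \<eta> \<le> \<bar>T n \<omega> - S n \<omega>\<bar>}"
      have char: "char (distr M borel U) t = (CLINT \<omega>|M. iexp (t * U \<omega>))"
        if [measurable]: "random_variable borel U" for U :: "'a \<Rightarrow> real"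
        unfolding char_def by (subst integral_distr) auto
      have int: "integrable M (\<lambda>\<omega>. iexp (t * U \<omega>))"
        if [measurable]: "random_variable borel U" for U :: "'a \<Rightarrow> real"
        by (rule integrable_const_bound[of _ 1]) auto
      have int_E: "integrable M (indicat_real ?E)"
        by (intro integrable_real_indicator) (auto simp: emeasure_eq_measure)
      have pt: "cmod (iexp (t * T n \<omega>) - iexp (t * S n \<omega>)) \<le> \<epsilon> / 4 + 2 * indicator ?E \<omega>"
        if "\<omega> \<in> space M" for \<omega>
      proof (cases "\<omega> \<in> ?E")
        case True
        then show ?thesis using norm_iexp_diff_le(2)[of "t * T n \<omega>" "t * S n \<omega>"] \<open>\<epsilon> > 0\<close> by simp
      next
        case False
        then have "\<bar>T n \<omega> - S n \<omega>\<bar> \<le> \<eta>" using that by simp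
        then have "\<bar>t\<bar> * \<bar>T n \<omega> - S n \<omega>\<bar> \<le> \<epsilon> / 4"
          using t\<eta> mult_left_mono[of "\<bar>T n \<omega> - S n \<omega>\<bar>" \<eta> "\<bar>t\<bar>"] by linarith
        then show ?thesis
          using norm_iexp_diff_le(1)[of "t * T n \<omega>" "t * S n \<omega>"] False
          by (simp flip: right_diff_distrib abs_mult)
      qed
      have "char (distr M borel (T n)) t - char (distr M borel (S n)) t
          = (CLINT \<omega>|M. iexp (t * T n \<omega>) - iexp (t * S n \<omega>))"
        by (simp only: char[OF S] char[OF T] Bochner_Integration.integral_diff[OF int[OF T] int[OF S]])
      then have "cmod (char (distr M borel (T n)) t - char (distr M borel (S n)) t)
          \<le> expectation (\<lambda>\<omega>. cmod (iexp (t * T n \<omega>) - iexp (t * S n \<omega>)))"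
        by (simp only: integral_norm_bound)
      also have "\<dots> \<le> expectation (\<lambda>\<omega>. \<epsilon> / 4 + 2 * indicator ?E \<omega>)"
        by (intro integral_mono pt integrable_norm Bochner_Integration.integrable_diff int S T
            Bochner_Integration.integrable_add Bochner_Integration.integrable_mult_right
            int_E) auto
      also have "\<dots> = \<epsilon> / 4 + 2 * prob ?E"
        using int_E
        by (subst Bochner_Integration.integral_add) (simp_all add: prob_space)
      also have "\<dots> < \<epsilon>" using elim \<open>\<epsilon> > 0\<close> by simp
      finally show ?case by simp
    qed
  qed
  from tendsto_add[OF this S_char]
  show "(\<lambda>n. char (distr M borel (T n)) t) \<longlonglongrightarrow> char N t"
    by simp
qed

section \<open>The studentized delta method in a Hilbert space\<close>

definition average :: "(nat \<Rightarrow> 'h::real_vector) \<Rightarrow> nat \<Rightarrow> 'h" where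
  "average x n = (1 / real n) *\<^sub>R (\<Sum>i<n. x i)"

text \<open>
  Root mean square, the \<open>L\<^sup>2\<close>-norm for the uniform distribution on \<open>{..<n}\<close>; it is \<open>0\<close> for \<open>n = 0\<close>.
\<close>

definition rms :: "(nat \<Rightarrow> real) \<Rightarrow> nat \<Rightarrow> real" where
  "rms f n = sqrt ((1 / real n) * (\<Sum>i<n. (f i)\<^sup>2))"

lemma rms_eq_L2_set: "rms f n = L2_set f {..<n} / sqrt (real n)"
  by (simp add: rms_def L2_set_def real_sqrt_mult real_sqrt_divide)

lemma rms_triangle: "rms (\<lambda>i. f i + g i) n \<le> rms f n + rms g n"
  unfolding rms_eq_L2_set add_divide_distrib[symmetric]
  by (intro divide_right_mono L2_set_triangle_ineq) simp

lemma rms_mono: "(\<And>i. \<bar>f i\<bar> \<le> g i) \<Longrightarrow> rms f n \<le> rms g n"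
  unfolding rms_def
  by (intro real_sqrt_le_mono mult_left_mono sum_mono) (auto simp: abs_le_square_iff[symmetric] intro: order_trans[OF _ abs_ge_self])

lemma rms_nonneg: "0 \<le> rms f n"
  by (simp add: rms_def sum_nonneg)

lemma rms_cmult: "0 \<le> c \<Longrightarrow> rms (\<lambda>i. c * f i) n = c * rms f n"
  by (simp add: rms_eq_L2_set L2_set_right_distrib)

lemma rms_const: "0 \<le> c \<Longrightarrow> rms (\<lambda>i. c) n \<le> c"
  by (cases "n = 0") (simp_all add: rms_def)

text \<open>
  This compares the studentizer with its counterpart at the true mean: replacing the centre \<open>m\<close>
  and the functional \<open>l\<close> by estimates \<open>y\<close> and \<open>l'\<close> changes it little. The proof is the triangle
  inequality in \<open>L\<^sup>2\<close>.
\<close>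

lemma rms_perturbation:
  fixes l l' :: "'h::real_normed_vector \<Rightarrow>\<^sub>L real"
  shows "\<bar>rms (\<lambda>i. l' (x i - y)) n - rms (\<lambda>i. l (x i - m)) n\<bar>
    \<le> norm (l' - l) * (rms (\<lambda>i. norm (x i - m)) n + norm (y - m)) + norm l * norm (y - m)"
proof -
  define d where "d i = l' (x i - y) - l (x i - m)" for i
  have d: "\<bar>d i\<bar> \<le> norm (l' - l) * norm (x i - m) + (norm (l' - l) + norm l) * norm (y - m)" for i
  proof -
    have "d i = (l' - l) (x i - m) - (l' - l) (y - m) - l (y - m)"
      by (simp add: d_def blinfun.diff_left blinfun.diff_right)
    moreover have "\<bar>(l' - l) (x i - m)\<bar> \<le> norm (l' - l) * norm (x i - m)"
      "\<bar>(l' - l) (y - m)\<bar> \<le> norm (l' - l) * norm (y - m)"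
      "\<bar>l (y - m)\<bar> \<le> norm l * norm (y - m)"
      using norm_blinfun[of "l' - l"] norm_blinfun[of l] by simp_all
    ultimately show ?thesis by (simp add: distrib_right)
  qed
  let ?D = "norm (l' - l) * (rms (\<lambda>i. norm (x i - m)) n + norm (y - m)) + norm l * norm (y - m)"
  have "rms (\<lambda>i. norm (l' - l) * norm (x i - m) + (norm (l' - l) + norm l) * norm (y - m)) n
    \<le> rms (\<lambda>i. norm (l' - l) * norm (x i - m)) n + rms (\<lambda>i. (norm (l' - l) + norm l) * norm (y - m)) n"
    by (rule rms_triangle)
  also have "\<dots> \<le> norm (l' - l) * rms (\<lambda>i. norm (x i - m)) n + (norm (l' - l) + norm l) * norm (y - m)"
    by (intro add_mono rms_const) (simp_all add: rms_cmult)
  also have "\<dots> = ?D" by (simp add: algebra_simps)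
  finally have *: "rms (\<lambda>i. norm (l' - l) * norm (x i - m) + (norm (l' - l) + norm l) * norm (y - m)) n \<le> ?D" .
  have "rms d n \<le> ?D" "rms (\<lambda>i. - d i) n \<le> ?D"
    using d by (auto intro!: order_trans[OF rms_mono *])
  moreover have "rms (\<lambda>i. l' (x i - y)) n \<le> rms (\<lambda>i. l (x i - m)) n + rms d n"
    using rms_triangle[of "\<lambda>i. l (x i - m)" d n] by (simp add: d_def)
  moreover have "rms (\<lambda>i. l (x i - m)) n \<le> rms (\<lambda>i. l' (x i - y)) n + rms (\<lambda>i. - d i) n"
    using rms_triangle[of "\<lambda>i. l' (x i - y)" "\<lambda>i. - d i" n] by (simp add: d_def)
  ultimately show ?thesis by linarith
qed

text \<open>
  The deterministic core of the delta method. The hypotheses on \<open>x\<close> describe what a sample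
  satisfies with high probability: its average is near \<open>m\<close>, even at the rate \<open>1/\<surd>n\<close>, its spread is
  bounded, and the empirical second moment of \<open>l m (x i - m)\<close> is near \<open>\<sigma>\<^sup>2\<close>. With \<open>y\<close> the average and
  \<open>s\<close> the studentizer, the studentized difference is \<open>L / s + R / s\<close>, where \<open>L = \<surd>n (l m) (y - m)\<close>
  satisfies \<open>\<bar>L\<bar> \<le> A * K\<close>, the remainder \<open>R\<close> is small by differentiability at \<open>m\<close>, and \<open>s\<close> is near \<open>\<sigma>\<close>,
  while the normalised sum is exactly \<open>L / \<sigma>\<close>.
\<close>

lemma studentized_expansion:
  fixes G :: "'h::real_normed_vector \<Rightarrow> real" and l :: "'h \<Rightarrow> 'h \<Rightarrow>\<^sub>L real"
  assumes der: "(G has_derivative l m) (at m)" and cont: "isCont l m"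
    and U: "open U" "m \<in> U" and pos: "\<sigma> > 0" "K > 0" "B \<ge> 0" "\<epsilon> > 0"
  obtains \<eta> where "\<eta> > 0"
    and "\<And>x n. n > 0 \<Longrightarrow> norm (average x n - m) < \<eta> \<Longrightarrow> sqrt (real n) * norm (average x n - m) \<le> K
      \<Longrightarrow> rms (\<lambda>i. norm (x i - m)) n \<le> B \<Longrightarrow> \<bar>(rms (\<lambda>i. l m (x i - m)) n)\<^sup>2 - \<sigma>\<^sup>2\<bar> < \<eta>
      \<Longrightarrow> average x n \<in> U \<and>
        \<bar>sqrt (real n) * (G (average x n) - G m) / rms (\<lambda>i. l (average x n) (x i - average x n)) n
         - (\<Sum>i<n. l m (x i - m)) / sqrt (real n * \<sigma>\<^sup>2)\<bar> < \<epsilon>"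
proof -
  define A where "A = norm (l m)"
  have "A \<ge> 0" by (simp add: A_def)
  have "(\<lambda>s. 1 / s) \<midarrow>\<sigma>\<rightarrow> 1 / \<sigma>"
    using \<open>\<sigma> > 0\<close> by (intro tendsto_intros) auto
  then obtain \<theta>0 where "\<theta>0 > 0" and \<theta>0: "\<And>s. s \<noteq> \<sigma> \<Longrightarrow> \<bar>s - \<sigma>\<bar> < \<theta>0 \<Longrightarrow> \<bar>1 / s - 1 / \<sigma>\<bar> < \<epsilon> / (2 * (A * K + 1))"
    unfolding LIM_eq real_norm_def
    using \<open>\<epsilon> > 0\<close> \<open>A \<ge> 0\<close> \<open>K > 0\<close> by (metis add_nonneg_pos divide_pos_pos less_eq_real_def mult_nonneg_nonneg mult_pos_pos zero_less_numeral zero_less_one)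
  define \<theta> where "\<theta> = min \<theta>0 (\<sigma> / 2)"
  have "\<theta> > 0" using \<open>\<theta>0 > 0\<close> \<open>\<sigma> > 0\<close> by (simp add: \<theta>_def)
  have \<theta>: "s \<ge> \<sigma> / 2 \<and> \<bar>1 / s - 1 / \<sigma>\<bar> < \<epsilon> / (2 * (A * K + 1))" if "\<bar>s - \<sigma>\<bar> < \<theta>" for s
  proof
    show "s \<ge> \<sigma> / 2" using that by (simp add: \<theta>_def abs_if split: if_splits)
    show "\<bar>1 / s - 1 / \<sigma>\<bar> < \<epsilon> / (2 * (A * K + 1))"
      using \<theta>0[of s] that \<open>\<epsilon> > 0\<close> \<open>A \<ge> 0\<close> \<open>K > 0\<close>
      by (cases "s = \<sigma>") (simp_all add: \<theta>_def add_nonneg_pos)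
  qed
  have "\<epsilon> * \<sigma> / (8 * K) > 0" using pos by simp
  then obtain \<eta>1 where "\<eta>1 > 0" and \<eta>1: "\<And>y. norm (y - m) < \<eta>1 \<Longrightarrow>
      \<bar>G y - G m - l m (y - m)\<bar> \<le> \<epsilon> * \<sigma> / (8 * K) * norm (y - m)"
    using der unfolding has_derivative_at_alt real_norm_def by blast
  have "(\<lambda>y. norm (l y - l m) * (B + norm (y - m)) + A * norm (y - m)) \<midarrow>m\<rightarrow> norm (l m - l m) * (B + norm (m - m)) + A * norm (m - m)"
    using cont unfolding isCont_def by (intro tendsto_intros)
  then have "\<forall>\<^sub>F y in at m. norm (l y - l m) * (B + norm (y - m)) + A * norm (y - m) < \<theta> / 2"
    using \<open>\<theta> > 0\<close> by (intro order_tendstoD(2)) auto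
  then obtain \<eta>2 where "\<eta>2 > 0" and \<eta>2': "\<And>y. y \<noteq> m \<Longrightarrow> dist y m < \<eta>2 \<Longrightarrow>
      norm (l y - l m) * (B + norm (y - m)) + A * norm (y - m) < \<theta> / 2"
    unfolding eventually_at by auto
  have \<eta>2: "norm (l y - l m) * (B + norm (y - m)) + A * norm (y - m) < \<theta> / 2" if "norm (y - m) < \<eta>2" for y
    using \<eta>2'[of y] that \<open>\<theta> > 0\<close> by (cases "y = m") (auto simp: dist_norm)
  obtain r where "r > 0" and r: "ball m r \<subseteq> U"
    using U open_contains_ball by blast
  define \<eta> where "\<eta> = min (min \<eta>1 \<eta>2) (min r (\<sigma> * \<theta> / 2))"
  show thesis
  proof
    show "\<eta> > 0" using \<open>\<eta>1 > 0\<close> \<open>\<eta>2 > 0\<close> \<open>r > 0\<close> \<open>\<sigma> > 0\<close> \<open>\<theta> > 0\<close> by (simp add: \<eta>_def)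
    fix x :: "nat \<Rightarrow> 'h" and n :: nat
    define y where "y = average x n"
    define s where "s = rms (\<lambda>i. l y (x i - y)) n"
    define a where "a = rms (\<lambda>i. l m (x i - m)) n"
    assume "n > 0" and *: "norm (average x n - m) < \<eta>" and **: "sqrt (real n) * norm (average x n - m) \<le> K"
      and b: "rms (\<lambda>i. norm (x i - m)) n \<le> B" and ***: "\<bar>(rms (\<lambda>i. l m (x i - m)) n)\<^sup>2 - \<sigma>\<^sup>2\<bar> < \<eta>"
    have y1: "norm (y - m) < \<eta>1" and y2: "norm (y - m) < \<eta>2" and y3: "norm (y - m) < r"
      using * by (simp_all add: y_def \<eta>_def)
    have nK: "sqrt (real n) * norm (y - m) \<le> K" using ** by (simp add: y_def)
    have "a \<ge> 0" by (simp add: a_def rms_nonneg)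
    have "\<bar>a - \<sigma>\<bar> < \<theta> / 2"
    proof -
      have "\<bar>a - \<sigma>\<bar> * \<sigma> \<le> \<bar>a - \<sigma>\<bar> * (a + \<sigma>)"
        using \<open>a \<ge> 0\<close> by (intro mult_left_mono) auto
      also have "\<dots> = \<bar>a\<^sup>2 - \<sigma>\<^sup>2\<bar>"
        using \<open>a \<ge> 0\<close> \<open>\<sigma> > 0\<close> by (simp add: power2_eq_square square_diff_square_factored abs_mult)
      also have "\<dots> < \<theta> / 2 * \<sigma>"
        using *** by (simp add: a_def \<eta>_def mult.commute)
      finally show ?thesis using \<open>\<sigma> > 0\<close> by simp
    qed
    moreover have "\<bar>s - a\<bar> < \<theta> / 2"
    proof -
      have "\<bar>s - a\<bar> \<le> norm (l y - l m) * (rms (\<lambda>i. norm (x i - m)) n + norm (y - m)) + A * norm (y - m)"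
        unfolding s_def a_def A_def by (rule rms_perturbation)
      also have "\<dots> \<le> norm (l y - l m) * (B + norm (y - m)) + A * norm (y - m)"
        using b by (intro add_mono mult_left_mono order_refl) auto
      also have "\<dots> < \<theta> / 2" by (rule \<eta>2[OF y2])
      finally show ?thesis .
    qed
    ultimately have "\<bar>s - \<sigma>\<bar> < \<theta>" by linarith
    from \<theta>[OF this] have s: "s \<ge> \<sigma> / 2" and s': "\<bar>1 / s - 1 / \<sigma>\<bar> < \<epsilon> / (2 * (A * K + 1))" by auto
    define L where "L = sqrt (real n) * l m (y - m)"
    define R where "R = sqrt (real n) * (G y - G m - l m (y - m))"
    have "\<bar>L\<bar> \<le> A * K"
    proof -
      have "\<bar>l m (y - m)\<bar> \<le> A * norm (y - m)" using norm_blinfun[of "l m" "y - m"] by (simp add: A_def)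
      then have "\<bar>L\<bar> \<le> sqrt (real n) * (A * norm (y - m))"
        by (simp add: L_def abs_mult mult_left_mono)
      also have "\<dots> = A * (sqrt (real n) * norm (y - m))" by simp
      also have "\<dots> \<le> A * K" using nK \<open>A \<ge> 0\<close> by (rule mult_left_mono)
      finally show ?thesis .
    qed
    have "\<bar>R\<bar> \<le> \<epsilon> * \<sigma> / 8"
    proof -
      have "\<bar>R\<bar> \<le> sqrt (real n) * (\<epsilon> * \<sigma> / (8 * K) * norm (y - m))"
        unfolding R_def abs_mult using \<eta>1[OF y1] by (intro mult_mono) auto
      also have "\<dots> = \<epsilon> * \<sigma> / (8 * K) * (sqrt (real n) * norm (y - m))" by simp
      also have "\<dots> \<le> \<epsilon> * \<sigma> / (8 * K) * K" using nK \<open>\<epsilon> * \<sigma> / (8 * K) > 0\<close> by (intro mult_left_mono) auto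
      also have "\<dots> = \<epsilon> * \<sigma> / 8" using \<open>K > 0\<close> by simp
      finally show ?thesis .
    qed
    have S: "(\<Sum>i<n. l m (x i - m)) / sqrt (real n * \<sigma>\<^sup>2) = L / \<sigma>"
    proof -
      have "(\<Sum>i<n. l m (x i - m)) = real n * l m (y - m)"
        using \<open>n > 0\<close>
        by (simp add: y_def average_def blinfun.diff_right blinfun.sum_right blinfun.scaleR_right
            sum_subtractf right_diff_distrib)
      also have "\<dots> = sqrt (real n) * L" by (simp add: L_def)
      finally show ?thesis using \<open>n > 0\<close> \<open>\<sigma> > 0\<close> by (simp add: real_sqrt_mult)
    qed
    have T: "sqrt (real n) * (G y - G m) / s = L / s + R / s"
      by (simp add: L_def R_def algebra_simps flip: add_divide_distrib)
    have "\<bar>R / s\<bar> \<le> (\<epsilon> * \<sigma> / 8) / (\<sigma> / 2)"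
      unfolding abs_divide using s \<open>\<bar>R\<bar> \<le> \<epsilon> * \<sigma> / 8\<close> \<open>\<sigma> > 0\<close> by (intro frac_le) auto
    also have "\<dots> < \<epsilon> / 2" using \<open>\<sigma> > 0\<close> \<open>\<epsilon> > 0\<close> by simp
    finally have 1: "\<bar>R / s\<bar> < \<epsilon> / 2" .
    have "\<bar>L / s - L / \<sigma>\<bar> = \<bar>L\<bar> * \<bar>1 / s - 1 / \<sigma>\<bar>"
      by (simp flip: abs_mult add: right_diff_distrib)
    also have "\<dots> \<le> (A * K + 1) * (\<epsilon> / (2 * (A * K + 1)))"
      using \<open>\<bar>L\<bar> \<le> A * K\<close> s' \<open>A \<ge> 0\<close> \<open>K > 0\<close> by (intro mult_mono) auto
    also have "\<dots> = \<epsilon> / 2"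
      using mult_nonneg_nonneg[OF \<open>A \<ge> 0\<close> less_imp_le[OF \<open>K > 0\<close>]] by (simp add: field_simps)
    finally have 2: "\<bar>L / s - L / \<sigma>\<bar> \<le> \<epsilon> / 2" .
    have "y \<in> U" using r y3 by (auto simp: dist_norm norm_minus_commute)
    moreover have "\<bar>sqrt (real n) * (G y - G m) / s - L / \<sigma>\<bar> < \<epsilon>"
      unfolding T using 1 2 by linarith
    ultimately show "average x n \<in> U \<and>
        \<bar>sqrt (real n) * (G (average x n) - G m) / rms (\<lambda>i. l (average x n) (x i - average x n)) n
         - (\<Sum>i<n. l m (x i - m)) / sqrt (real n * \<sigma>\<^sup>2)\<bar> < \<epsilon>"
      unfolding S by (simp add: y_def s_def)
  qed
qed

text \<open>
  The values of \<open>T n\<close> off the event that the average lies in \<open>U\<close> are arbitrary, as the probability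
  of that event tends to \<open>1\<close>. By \<open>slutsky\<close> it suffices that \<open>T n\<close> differs little from the
  normalised sum \<open>S n\<close> of the variables \<open>l m (Y i - m)\<close>. By \<open>studentized_expansion\<close> this is so
  outside of the events \<open>E1 n, \<dots>, E4 n\<close> below; \<open>E2 n\<close> and \<open>E3 n\<close> are made improbable, for all
  \<open>n\<close>, by the choice of \<open>K\<close>, and the probabilities of \<open>E1 n\<close> and \<open>E4 n\<close> tend to \<open>0\<close>.
\<close>

theorem (in prob_space) studentized_delta_method:
  fixes Y :: "nat \<Rightarrow> 'a \<Rightarrow> 'h::{real_inner, banach, second_countable_topology}"
    and G :: "'h \<Rightarrow> real" and l :: "'h \<Rightarrow> 'h \<Rightarrow>\<^sub>L real" and T :: "nat \<Rightarrow> 'a \<Rightarrow> real"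
  assumes indep: "indep_vars (\<lambda>_. borel) Y UNIV"
    and ident: "\<And>i. distr M borel (Y i) = distr M borel (Y 0)"
    and moment: "integrable M (\<lambda>\<omega>. (norm (Y 0 \<omega>))\<^sup>2)"
    and m_def: "m = expectation (Y 0)"
    and der: "(G has_derivative l m) (at m)" and cont: "isCont l m"
    and U: "open U" "m \<in> U"
    and pos: "expectation (\<lambda>\<omega>. (l m (Y 0 \<omega> - m))\<^sup>2) > 0"
    and T_meas[measurable]: "\<And>n. random_variable borel (T n)"
    and T: "\<And>n \<omega>. average (\<lambda>i. Y i \<omega>) n \<in> U \<Longrightarrow>
      T n \<omega> = sqrt (real n) * (G (average (\<lambda>i. Y i \<omega>) n) - G m)
        / rms (\<lambda>i. l (average (\<lambda>i. Y i \<omega>) n) (Y i \<omega> - average (\<lambda>i. Y i \<omega>) n)) n"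
  shows "weak_conv_m (\<lambda>n. distr M borel (T n)) std_normal_distribution"
proof -
  have rv[measurable]: "random_variable borel (Y i)" for i
    using indep by (simp add: indep_vars_def)
  have int0: "integrable M (Y 0)"
    by (rule integrable_of_square_integrable[OF rv moment])
  have same: "integrable M (\<lambda>\<omega>. g (Y i \<omega>)) \<longleftrightarrow> integrable M (\<lambda>\<omega>. g (Y 0 \<omega>))"
    "expectation (\<lambda>\<omega>. g (Y i \<omega>)) = expectation (\<lambda>\<omega>. g (Y 0 \<omega>))"
    if "g \<in> borel_measurable borel" for i and g :: "'h \<Rightarrow> 'k::{banach, second_countable_topology}"
    using identically_distributed_expectation[OF rv rv that ident[of i]] by auto
  define Z where "Z i \<omega> = Y i \<omega> - m" for i \<omega>
  define V where "V = expectation (\<lambda>\<omega>. (norm (Z 0 \<omega>))\<^sup>2)"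
  define W where "W i \<omega> = (l m (Z i \<omega>))\<^sup>2" for i \<omega>
  define \<sigma> where "\<sigma> = sqrt (expectation (W 0))"
  have "V \<ge> 0" by (simp add: V_def)
  have \<sigma>: "\<sigma> > 0" "\<sigma>\<^sup>2 = expectation (W 0)"
    using pos by (simp_all add: \<sigma>_def W_def[abs_def] Z_def)
  have l_meas[measurable]: "blinfun_apply (l m) \<in> borel_measurable borel"
    by (intro borel_measurable_continuous_onI continuous_intros)
  have Z_meas[measurable]: "random_variable borel (Z i)" for i
    unfolding Z_def by measurable
  have W_meas[measurable]: "random_variable borel (W i)" for i
    unfolding W_def by measurable
  have Z_indep: "indep_vars (\<lambda>_. borel) Z UNIV"
    unfolding Z_def[abs_def] by (rule indep_vars_compose2[OF indep]) simp
  have intZ2_0: "integrable M (\<lambda>\<omega>. (norm (Z 0 \<omega>))\<^sup>2)"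
    unfolding Z_def by (rule square_integrable_centered[OF rv moment])
  have intZ2: "integrable M (\<lambda>\<omega>. (norm (Z i \<omega>))\<^sup>2)" for i
    using intZ2_0 same(1)[of "\<lambda>y. (norm (y - m))\<^sup>2" i] by (simp add: Z_def)
  have EZ2: "expectation (\<lambda>\<omega>. (norm (Z i \<omega>))\<^sup>2) = V" for i
    using same(2)[of "\<lambda>y. (norm (y - m))\<^sup>2" i] by (simp add: Z_def V_def)
  have intZ: "integrable M (Z i)" for i
    by (rule integrable_of_square_integrable[OF Z_meas intZ2])
  have EZ: "expectation (Z i) = 0" for i
    using same(2)[of "\<lambda>y. y - m" i] int0 by (simp add: Z_def[abs_def] prob_space m_def)
  note mom = second_moment_sum_indep[OF Z_indep EZ intZ2 EZ2]
  have intW: "integrable M (W i)" for i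
  proof (rule Bochner_Integration.integrable_bound)
    show "integrable M (\<lambda>\<omega>. (norm (l m))\<^sup>2 * (norm (Z i \<omega>))\<^sup>2)"
      using intZ2 by simp
    have "\<bar>W i \<omega>\<bar> \<le> (norm (l m) * norm (Z i \<omega>))\<^sup>2" for \<omega>
      using norm_blinfun[of "l m" "Z i \<omega>"] by (simp add: W_def flip: abs_le_square_iff)
    then show "AE \<omega> in M. norm (W i \<omega>) \<le> norm ((norm (l m))\<^sup>2 * (norm (Z i \<omega>))\<^sup>2)"
      by (simp add: power_mult_distrib)
  qed measurable
  have W_indep: "indep_vars (\<lambda>_. borel) W UNIV"
    unfolding W_def[abs_def] by (rule indep_vars_compose2[OF Z_indep]) measurable
  have W_ident: "distr M borel (W i) = distr M borel (W 0)" for i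
  proof -
    have "distr M borel (W i) = distr (distr M borel (Y i)) borel (\<lambda>y. (l m (y - m))\<^sup>2)" for i
      by (subst distr_distr) (auto simp: W_def[abs_def] Z_def comp_def)
    then show ?thesis using ident[of i] by simp
  qed
  define S where "S n \<omega> = (\<Sum>i<n. l m (Z i \<omega>)) / sqrt (real n * \<sigma>\<^sup>2)" for n \<omega>
  have S_meas[measurable]: "random_variable borel (S n)" for n
    unfolding S_def by measurable
  have clt: "weak_conv_m (\<lambda>n. distr M borel (S n)) std_normal_distribution"
    unfolding S_def[abs_def]
  proof (rule central_limit_theorem_zero_mean)
    show "indep_vars (\<lambda>_. borel) (\<lambda>i \<omega>. l m (Z i \<omega>)) UNIV"
      by (rule indep_vars_compose2[OF Z_indep]) measurable
    show mean0: "expectation (\<lambda>\<omega>. l m (Z i \<omega>)) = 0" for i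
      using integral_bounded_linear[OF blinfun.bounded_linear_right[of "l m"] intZ[of i]] by (simp add: EZ blinfun.zero_right)
    show "integrable M (\<lambda>\<omega>. (l m (Z i \<omega>))\<^sup>2)" for i
      using intW[of i] by (simp add: W_def[abs_def])
    show "variance (\<lambda>\<omega>. l m (Z i \<omega>)) = \<sigma>\<^sup>2" for i
      unfolding mean0 using same(2)[of "\<lambda>y. (l m (y - m))\<^sup>2" i]
      by (simp add: \<sigma> W_def[abs_def] Z_def)
    have "distr M borel (\<lambda>\<omega>. l m (Z i \<omega>)) = distr (distr M borel (Y i)) borel (\<lambda>y. l m (y - m))" for i
      by (subst distr_distr) (auto simp: Z_def comp_def)
    then show "distr M borel (\<lambda>\<omega>. l m (Z i \<omega>)) = distr (distr M borel (Y 0)) borel (\<lambda>y. l m (y - m))" for i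
      using ident[of i] by simp
  qed (rule \<sigma>)
  show ?thesis
  proof (rule slutsky[OF S_meas T_meas _ clt])
    show "real_distribution std_normal_distribution"
      by (rule real_dist_normal_dist)
    fix \<epsilon> :: real assume "\<epsilon> > 0"
    show "(\<lambda>n. prob {\<omega>\<in>space M. \<epsilon> \<le> \<bar>T n \<omega> - S n \<omega>\<bar>}) \<longlonglongrightarrow> 0"
    proof (rule tendstoI)
      fix \<tau> :: real assume "\<tau> > 0"
      define K where "K = sqrt (4 * V / \<tau> + 1)"
      have K2: "K\<^sup>2 = 4 * V / \<tau> + 1" and "K > 0"
        using \<open>V \<ge> 0\<close> \<open>\<tau> > 0\<close> by (simp_all add: K_def add_nonneg_pos)
      have VK: "V / K\<^sup>2 < \<tau> / 4"
      proof -
        have "4 * V < \<tau> * K\<^sup>2" using \<open>\<tau> > 0\<close> by (simp add: K2 distrib_left)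
        then show ?thesis using \<open>K > 0\<close> by (simp add: field_simps)
      qed
      obtain \<eta> where "\<eta> > 0" and \<eta>: "\<And>x n. n > 0 \<Longrightarrow> norm (average x n - m) < \<eta> \<Longrightarrow>
          sqrt (real n) * norm (average x n - m) \<le> K
          \<Longrightarrow> rms (\<lambda>i. norm (x i - m)) n \<le> K \<Longrightarrow> \<bar>(rms (\<lambda>i. l m (x i - m)) n)\<^sup>2 - \<sigma>\<^sup>2\<bar> < \<eta>
          \<Longrightarrow> average x n \<in> U \<and>
            \<bar>sqrt (real n) * (G (average x n) - G m) / rms (\<lambda>i. l (average x n) (x i - average x n)) n
             - (\<Sum>i<n. l m (x i - m)) / sqrt (real n * \<sigma>\<^sup>2)\<bar> < \<epsilon>"
        using studentized_expansion[OF der cont U \<sigma>(1) \<open>K > 0\<close> less_imp_le[OF \<open>K > 0\<close>] \<open>\<epsilon> > 0\<close>] by metis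
      let ?Q = "\<lambda>n \<omega>. (norm (\<Sum>i<n. Z i \<omega>))\<^sup>2"
      define E1 where "E1 n = {\<omega>\<in>space M. (real n * \<eta>)\<^sup>2 \<le> ?Q n \<omega>}" for n
      define E2 where "E2 n = {\<omega>\<in>space M. real n * K\<^sup>2 \<le> ?Q n \<omega>}" for n
      define E3 where "E3 n = {\<omega>\<in>space M. real n * K\<^sup>2 \<le> (\<Sum>i<n. (norm (Z i \<omega>))\<^sup>2)}" for n
      define E4 where "E4 n = {\<omega>\<in>space M. \<eta> \<le> \<bar>(\<Sum>i<n. W i \<omega>) / real n - \<sigma>\<^sup>2\<bar>}" for n
      have [measurable]: "E1 n \<in> events" "E2 n \<in> events" "E3 n \<in> events" "E4 n \<in> events" for n
        unfolding E1_def E2_def E3_def E4_def by measurable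
      have sub: "{\<omega>\<in>space M. \<epsilon> \<le> \<bar>T n \<omega> - S n \<omega>\<bar>} \<subseteq> E1 n \<union> E2 n \<union> (E3 n \<union> E4 n)" if "n > 0" for n
      proof
        fix \<omega> assume \<omega>: "\<omega> \<in> {\<omega>\<in>space M. \<epsilon> \<le> \<bar>T n \<omega> - S n \<omega>\<bar>}"
        show "\<omega> \<in> E1 n \<union> E2 n \<union> (E3 n \<union> E4 n)"
        proof (rule ccontr)
          assume "\<not> ?thesis"
          with \<omega> have 1: "?Q n \<omega> < (real n * \<eta>)\<^sup>2" and 2: "?Q n \<omega> < real n * K\<^sup>2"
            and 3: "(\<Sum>i<n. (norm (Z i \<omega>))\<^sup>2) < real n * K\<^sup>2"
            and 4: "\<bar>(\<Sum>i<n. W i \<omega>) / real n - \<sigma>\<^sup>2\<bar> < \<eta>"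
            by (auto simp: E1_def E2_def E3_def E4_def)
          let ?y = "average (\<lambda>i. Y i \<omega>) n"
          have y: "?y - m = (1 / real n) *\<^sub>R (\<Sum>i<n. Z i \<omega>)"
            using \<open>n > 0\<close>
            by (simp add: average_def Z_def sum_subtractf scaleR_diff_right sum_constant_scaleR)
          have ny: "norm (?y - m) = norm (\<Sum>i<n. Z i \<omega>) / real n"
            unfolding y using \<open>n > 0\<close> by simp
          have "norm (\<Sum>i<n. Z i \<omega>) < real n * \<eta>"
            using 1 \<open>\<eta> > 0\<close> by (intro power2_less_imp_less[OF 1]) simp
          then have A: "norm (?y - m) < \<eta>"
            unfolding ny using \<open>n > 0\<close> by (simp add: field_simps)
          have B: "sqrt (real n) * norm (?y - m) \<le> K"
          proof (rule power2_le_imp_le)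
            have "(sqrt (real n) * norm (?y - m))\<^sup>2 = ?Q n \<omega> / real n"
              unfolding ny using \<open>n > 0\<close> by (simp add: power_mult_distrib power_divide) (simp add: power2_eq_square)
            also have "\<dots> \<le> K\<^sup>2" using 2 \<open>n > 0\<close> by (simp add: field_simps)
            finally show "(sqrt (real n) * norm (?y - m))\<^sup>2 \<le> K\<^sup>2" .
          qed (use \<open>K > 0\<close> in simp)
          have C: "rms (\<lambda>i. norm (Y i \<omega> - m)) n \<le> K"
            unfolding rms_def
          proof (rule real_le_lsqrt)
            show "1 / real n * (\<Sum>i<n. (norm (Y i \<omega> - m))\<^sup>2) \<le> K\<^sup>2"
              using 3 \<open>n > 0\<close> by (simp add: Z_def field_simps)
          qed (use \<open>K > 0\<close> in simp)
          have "(rms (\<lambda>i. l m (Y i \<omega> - m)) n)\<^sup>2 = (\<Sum>i<n. W i \<omega>) / real n"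
            by (simp add: rms_def W_def Z_def sum_nonneg)
          with 4 have D: "\<bar>(rms (\<lambda>i. l m (Y i \<omega> - m)) n)\<^sup>2 - \<sigma>\<^sup>2\<bar> < \<eta>"
            by simp
          from \<eta>[OF \<open>n > 0\<close> A B C D] have "\<bar>T n \<omega> - S n \<omega>\<bar> < \<epsilon>"
            by (simp add: T S_def Z_def)
          with \<omega> show False by simp
        qed
      qed
      have P1: "prob (E1 n) \<le> V / \<eta>\<^sup>2 / real n" if "n > 0" for n
      proof -
        have "prob (E1 n) \<le> expectation (?Q n) / (real n * \<eta>)\<^sup>2"
          unfolding E1_def using mom(1)[of n] that \<open>\<eta> > 0\<close>
          by (intro integral_Markov_inequality_measure[where A = "{}"]) auto
        also have "\<dots> = V / \<eta>\<^sup>2 / real n"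
          using that \<open>\<eta> > 0\<close> by (simp only: mom(2)) (simp add: power2_eq_square)
        finally show ?thesis .
      qed
      have P2: "prob (E2 n) \<le> V / K\<^sup>2" if "n > 0" for n
      proof -
        have "prob (E2 n) \<le> expectation (?Q n) / (real n * K\<^sup>2)"
          unfolding E2_def using mom(1)[of n] that \<open>K > 0\<close>
          by (intro integral_Markov_inequality_measure[where A = "{}"]) auto
        also have "\<dots> = V / K\<^sup>2"
          using that by (simp only: mom(2)) simp
        finally show ?thesis .
      qed
      have P3: "prob (E3 n) \<le> V / K\<^sup>2" if "n > 0" for n
      proof -
        have "prob (E3 n) \<le> expectation (\<lambda>\<omega>. \<Sum>i<n. (norm (Z i \<omega>))\<^sup>2) / (real n * K\<^sup>2)"
          unfolding E3_def using intZ2 that \<open>K > 0\<close>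
          by (intro integral_Markov_inequality_measure[where A = "{}"]) (auto intro!: sum_nonneg AE_I2)
        also have "\<dots> = V / K\<^sup>2"
          using that by (simp add: Bochner_Integration.integral_sum intZ2 EZ2)
        finally show ?thesis .
      qed
      have "(\<lambda>n. prob (E4 n)) \<longlonglongrightarrow> 0"
        unfolding E4_def \<sigma>(2) by (rule weak_law_of_large_numbers[OF W_indep W_ident intW \<open>\<eta> > 0\<close>])
      then have "\<forall>\<^sub>F n in sequentially. prob (E4 n) < \<tau> / 4"
        using \<open>\<tau> > 0\<close> by (intro order_tendstoD) auto
      moreover have "\<forall>\<^sub>F n in sequentially. V / \<eta>\<^sup>2 / real n < \<tau> / 4"
        using \<open>\<tau> > 0\<close> by (intro order_tendstoD(2)[OF lim_const_over_n]) auto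
      ultimately show "\<forall>\<^sub>F n in sequentially. dist (prob {\<omega>\<in>space M. \<epsilon> \<le> \<bar>T n \<omega> - S n \<omega>\<bar>}) 0 < \<tau>"
        using eventually_gt_at_top[of 0]
      proof eventually_elim
        case (elim n)
        have "prob {\<omega>\<in>space M. \<epsilon> \<le> \<bar>T n \<omega> - S n \<omega>\<bar>} \<le> prob (E1 n \<union> E2 n \<union> (E3 n \<union> E4 n))"
          by (intro finite_measure_mono sub elim) auto
        also have "\<dots> \<le> (prob (E1 n) + prob (E2 n)) + (prob (E3 n) + prob (E4 n))"
          by (intro order_trans[OF measure_Un_le] add_mono) auto
        also have "\<dots> < \<tau>"
          using P1[of n] P2[of n] P3[of n] VK elim by linarith
        finally show ?case by simp
      qed
    qed
  qed
qed

section \<open>The projection and its differential\<close>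

definition proj_deriv :: "('m \<Rightarrow> 'h::real_normed_vector) \<Rightarrow> 'h \<Rightarrow> 'h \<Rightarrow>\<^sub>L 'h" where
  "proj_deriv j y = Blinfun (frechet_derivative (proj_onto j) (at y))"

lemma open_proj_domain: "open (proj_domain j)"
  unfolding proj_domain_def by (intro open_Union) auto

lemma proj_onto_nearest: "\<exists>!q. q \<in> nearest_points j y \<Longrightarrow> proj_onto j y \<in> nearest_points j y"
  unfolding proj_onto_def by (rule theI')

lemma proj_onto_in_range:
  fixes j :: "'m \<Rightarrow> 'h::real_normed_vector"
  assumes "y \<in> proj_domain j"
  shows "proj_onto j y \<in> range j"
proof -
  from assms obtain U where "y \<in> U" and "U \<in> {U. open U \<and> (\<forall>y\<in>U. \<exists>!q. q \<in> nearest_points j y) \<and>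
     (\<exists>D :: 'h \<Rightarrow> 'h \<Rightarrow>\<^sub>L 'h. continuous_on U D \<and>
        (\<forall>y\<in>U. (proj_onto j has_derivative blinfun_apply (D y)) (at y)))}"
    unfolding proj_domain_def by (rule UnionE)
  then have "\<exists>!q. q \<in> nearest_points j y"
    by (simp only: mem_Collect_eq)
  then have "proj_onto j y \<in> nearest_points j y"
    by (rule proj_onto_nearest)
  then show ?thesis
    by (simp add: nearest_points_def)
qed

text \<open>
  Derivatives being unique, the local continuous derivatives that \<open>proj_domain\<close> provides all agree
  with \<open>proj_deriv\<close>.
\<close>

lemma proj_deriv_properties:
  assumes "y \<in> proj_domain j"
  shows proj_onto_has_derivative: "(proj_onto j has_derivative proj_deriv j y) (at y)"
    and frechet_derivative_proj_onto: "frechet_derivative (proj_onto j) (at y) = proj_deriv j y"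
    and isCont_proj_deriv: "isCont (proj_deriv j) y"
proof -
  obtain U D where U: "open U" "y \<in> U" and D: "continuous_on U D"
    and der: "\<And>z. z \<in> U \<Longrightarrow> (proj_onto j has_derivative blinfun_apply (D z)) (at z)"
    using assms unfolding proj_domain_def by blast
  have fd: "frechet_derivative (proj_onto j) (at z) = blinfun_apply (D z)" if "z \<in> U" for z
    using frechet_derivative_at[OF der[OF that]] by simp
  have eq: "proj_deriv j z = D z" if "z \<in> U" for z
    by (simp add: proj_deriv_def fd[OF that] blinfun_apply_inverse)
  show "(proj_onto j has_derivative proj_deriv j y) (at y)"
    "frechet_derivative (proj_onto j) (at y) = proj_deriv j y"
    using der[OF U(2)] fd[OF U(2)] eq[OF U(2)] by simp_all
  have "continuous_on U (proj_deriv j)"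
    using D eq by (metis continuous_on_cong)
  then show "isCont (proj_deriv j) y"
    using U by (simp add: continuous_on_eq_continuous_at)
qed

lemma isCont_proj_onto: "y \<in> proj_domain j \<Longrightarrow> isCont (proj_onto j) y"
  by (rule has_derivative_continuous[OF proj_onto_has_derivative])

section \<open>Tangent spaces of an embedded manifold\<close>

lemma chart_at_props:
  assumes "hilbert_manifold A"
  shows chart_at_in: "chart_at A x \<in> A" and chart_at_mem: "x \<in> fst (chart_at A x)"
    and open_chart_domain: "open (fst (chart_at A x))"
    and open_chart_image: "open (snd (chart_at A x) ` fst (chart_at A x))"
    and chart_homeomorphism: "homeomorphism (fst (chart_at A x)) (snd (chart_at A x) ` fst (chart_at A x))
      (snd (chart_at A x)) (inv_into (fst (chart_at A x)) (snd (chart_at A x)))"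
proof -
  have "x \<in> (\<Union>c\<in>A. fst c)"
    using assms by (simp add: hilbert_manifold_def)
  then have "\<exists>c. c \<in> A \<and> x \<in> fst c"
    by blast
  from someI_ex[OF this] show in_A: "chart_at A x \<in> A" and "x \<in> fst (chart_at A x)"
    by (simp_all add: chart_at_def)
  have "is_chart (chart_at A x)"
    using assms in_A by (simp add: hilbert_manifold_def)
  then show "open (fst (chart_at A x))" "open (snd (chart_at A x) ` fst (chart_at A x))"
    "homeomorphism (fst (chart_at A x)) (snd (chart_at A x) ` fst (chart_at A x))
      (snd (chart_at A x)) (inv_into (fst (chart_at A x)) (snd (chart_at A x)))"
    by (auto simp: is_chart_def case_prod_unfold)
qed

lemma local_rep_chart:
  assumes "hilbert_manifold A" "z \<in> fst (chart_at A x)"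
  shows "local_rep (chart_at A x) f (snd (chart_at A x) z) = f z"
  using homeomorphism_apply1[OF chart_homeomorphism[OF assms(1)] assms(2)]
  by (simp add: local_rep_def)

lemma differential_has_derivative:
  assumes "hilbert_manifold A" "differentiable_map A f"
  shows "(local_rep (chart_at A x) f has_derivative differential A f x) (at (snd (chart_at A x) x))"
proof -
  have "local_rep (chart_at A x) f differentiable_on snd (chart_at A x) ` fst (chart_at A x)"
    using assms(2) chart_at_in[OF assms(1)] by (simp add: differentiable_map_def)
  then have "local_rep (chart_at A x) f differentiable (at (snd (chart_at A x) x))"
    using open_chart_image[OF assms(1)] chart_at_mem[OF assms(1)]
    by (metis differentiable_on_def at_within_open imageI)
  then show ?thesis
    unfolding differential_def by (simp add: frechet_derivative_works)
qed

lemma bounded_linear_differential: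
  assumes "hilbert_manifold A" "differentiable_map A f"
  shows "bounded_linear (differential A f x)"
  by (rule has_derivative_bounded_linear[OF differential_has_derivative[OF assms]])

lemma hilbert_embeddingD:
  assumes "hilbert_embedding A j"
  shows "inj j" "differentiable_map A j" "inj (differential A j x)"
  using assms by (auto simp: hilbert_embedding_def)

lemma continuous_on_embedding:
  assumes "hilbert_embedding A j"
  shows "continuous_on UNIV j"
proof -
  have opens: "\<forall>S. open S \<longleftrightarrow> (\<exists>V. open V \<and> S = j -` V)"
    using assms unfolding hilbert_embedding_def by (elim conjE)
  have "open (j -` V)" if "open V" for V
    using spec[OF opens, of "j -` V"] that by blast
  then show ?thesis
    by (simp add: continuous_on_open_vimage)
qed

text \<open>
  The inverse of \<open>j\<close> is continuous on \<open>j(M)\<close>, because \<open>j\<close> induces the topology of the manifold.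
\<close>

lemma tendsto_inv_embedding:
  assumes emb: "hilbert_embedding A j" and lim: "(\<gamma> \<longlongrightarrow> j x) F"
    and ran: "\<forall>\<^sub>F t in F. \<gamma> t \<in> range j"
  shows "((\<lambda>t. inv j (\<gamma> t)) \<longlongrightarrow> x) F"
proof (rule topological_tendstoI)
  fix S assume "open S" "x \<in> S"
  have opens: "\<forall>S. open S \<longleftrightarrow> (\<exists>V. open V \<and> S = j -` V)"
    using emb unfolding hilbert_embedding_def by (elim conjE)
  obtain V where V: "open V" "S = j -` V"
    using spec[OF opens, of S] \<open>open S\<close> by blast
  have "\<forall>\<^sub>F t in F. \<gamma> t \<in> V"
    using lim V \<open>x \<in> S\<close> by (intro topological_tendstoD) auto
  then show "\<forall>\<^sub>F t in F. inv j (\<gamma> t) \<in> S"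
    using ran by eventually_elim (auto simp: V f_inv_into_f)
qed

lemma differential_bounded_below:
  assumes "hilbert_manifold A" "hilbert_embedding A j" "closed (range (differential A j x))"
  obtains C where "C > 0" "\<And>v. norm v \<le> C * norm (differential A j x v)"
  using bounded_below_of_closed_range[OF bounded_linear_differential[OF assms(1)
      hilbert_embeddingD(2)[OF assms(2)]] assms(3) hilbert_embeddingD(3)[OF assms(2)]] by blast

text \<open>
  If \<open>j\<close> were continuously differentiable, the curve could be pulled back to a differentiable
  curve in the manifold. Here \<open>j\<close> is only differentiable, and the pulled back curve \<open>u\<close> is known to
  be continuous. Since the differential \<open>L\<close> of \<open>j\<close> is bounded below, the displacement of \<open>\<gamma>\<close>
  controls that of \<open>u\<close>, so that \<open>u t - u 0 = O(t)\<close>. The vectors \<open>L ((u t - u 0) / t)\<close> then tend to \<open>w\<close>,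
  which therefore lies in the closed range of \<open>L\<close>.
\<close>

lemma velocity_in_tangent_image:
  assumes man: "hilbert_manifold A" and emb: "hilbert_embedding A j"
    and cl: "closed (range (differential A j (inv j (\<gamma> 0))))"
    and der: "(\<gamma> has_vector_derivative w) (at (0::real))"
    and ran0: "\<gamma> 0 \<in> range j" and ran: "\<forall>\<^sub>F t in at 0. \<gamma> t \<in> range j"
  shows "w \<in> tangent_image A j (\<gamma> 0)"
proof -
  define x where "x = inv j (\<gamma> 0)"
  define \<psi> where "\<psi> = snd (chart_at A x)"
  define L where "L = differential A j x"
  define \<phi> where "\<phi> = local_rep (chart_at A x) j"
  define u where "u t = \<psi> (inv j (\<gamma> t))" for t
  have jx: "j x = \<gamma> 0" using ran0 by (simp add: x_def f_inv_into_f)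
  note chart = open_chart_domain[OF man, of x] chart_at_mem[OF man, of x]
  interpret L: bounded_linear L
    unfolding L_def by (rule bounded_linear_differential[OF man hilbert_embeddingD(2)[OF emb]])
  obtain C where "C > 0" and C: "\<And>v. norm v \<le> C * norm (L v)"
    using differential_bounded_below[OF man emb cl] unfolding L_def x_def by blast
  have \<phi>: "(\<phi> has_derivative L) (at (\<psi> x))"
    unfolding \<phi>_def L_def \<psi>_def by (rule differential_has_derivative[OF man hilbert_embeddingD(2)[OF emb]])
  have "(\<gamma> \<longlongrightarrow> j x) (at 0)"
    using has_vector_derivative_continuous[OF der] by (simp add: jx isCont_def)
  then have lim: "((\<lambda>t. inv j (\<gamma> t)) \<longlongrightarrow> x) (at 0)"
    by (rule tendsto_inv_embedding[OF emb _ ran])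
  have "continuous_on (fst (chart_at A x)) \<psi>"
    using chart_homeomorphism[OF man] by (auto simp: homeomorphism_def \<psi>_def)
  then have "isCont \<psi> x"
    using chart by (simp add: continuous_on_eq_continuous_at)
  then have ulim: "(u \<longlongrightarrow> \<psi> x) (at 0)"
    unfolding u_def using lim by (rule isCont_tendsto_compose)
  have "\<forall>\<^sub>F t in at 0. inv j (\<gamma> t) \<in> fst (chart_at A x)"
    using lim chart by (intro topological_tendstoD) auto
  then have \<phi>u: "\<forall>\<^sub>F t in at 0. \<phi> (u t) = \<gamma> t"
    using ran by eventually_elim (simp add: \<phi>_def u_def \<psi>_def local_rep_chart[OF man] f_inv_into_f)
  have \<phi>x: "\<phi> (\<psi> x) = \<gamma> 0"
    by (simp add: \<phi>_def \<psi>_def local_rep_chart[OF man chart(2)] jx)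
  have lin: "\<forall>\<^sub>F t in at 0. norm (\<gamma> t - \<gamma> 0 - L (u t - \<psi> x)) \<le> e * norm (u t - \<psi> x)" if "e > 0" for e
  proof -
    obtain d where "d > 0" and d: "\<And>v. norm (v - \<psi> x) < d \<Longrightarrow>
        norm (\<phi> v - \<phi> (\<psi> x) - L (v - \<psi> x)) \<le> e * norm (v - \<psi> x)"
      using \<phi> \<open>e > 0\<close> unfolding has_derivative_at_alt by blast
    have "\<forall>\<^sub>F t in at 0. dist (u t) (\<psi> x) < d"
      using ulim \<open>d > 0\<close> by (rule tendstoD)
    then show ?thesis
      using \<phi>u
    proof eventually_elim
      case (elim t)
      then show ?case using d[of "u t"] by (simp add: dist_norm \<phi>x)
    qed
  qed
  have vel: "\<forall>\<^sub>F t in at 0. norm (\<gamma> t - \<gamma> 0 - t *\<^sub>R w) \<le> e * \<bar>t\<bar>" if "e > 0" for e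
  proof -
    obtain d where "d > 0" and d: "\<And>t. \<bar>t - 0\<bar> < d \<Longrightarrow> norm (\<gamma> t - \<gamma> 0 - (t - 0) *\<^sub>R w) \<le> e * \<bar>t - 0\<bar>"
      using der \<open>e > 0\<close> unfolding has_vector_derivative_def has_derivative_at_alt real_norm_def by blast
    then show ?thesis
      unfolding eventually_at by (intro exI[of _ d]) (auto simp: dist_norm)
  qed
  \<comment> \<open>the coordinates of the curve move at bounded speed\<close>
  define K where "K = 2 * C * (norm w + 1)"
  have "K > 0" using \<open>C > 0\<close> by (simp add: K_def add_nonneg_pos)
  have c1: "1 / (2 * C) > 0" using \<open>C > 0\<close> by simp
  have speed: "\<forall>\<^sub>F t in at 0. norm (u t - \<psi> x) \<le> K * \<bar>t\<bar>"
    using lin[OF c1] vel[OF zero_less_one]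
  proof eventually_elim
    case (elim t)
    have l: "norm (\<gamma> t - \<gamma> 0 - L (u t - \<psi> x)) \<le> 1 / (2 * C) * norm (u t - \<psi> x)"
      and v: "norm (\<gamma> t - \<gamma> 0 - t *\<^sub>R w) \<le> \<bar>t\<bar>"
      using elim \<open>C > 0\<close> by simp_all
    have "norm (\<gamma> t - \<gamma> 0) \<le> norm (t *\<^sub>R w) + norm (\<gamma> t - \<gamma> 0 - t *\<^sub>R w)"
      using norm_triangle_ineq[of "t *\<^sub>R w" "\<gamma> t - \<gamma> 0 - t *\<^sub>R w"] by simp
    also have "\<dots> \<le> (norm w + 1) * \<bar>t\<bar>" using v by (simp add: algebra_simps)
    finally have g: "norm (\<gamma> t - \<gamma> 0) \<le> (norm w + 1) * \<bar>t\<bar>" .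
    have "norm (L (u t - \<psi> x)) \<le> norm (\<gamma> t - \<gamma> 0) + norm (\<gamma> t - \<gamma> 0 - L (u t - \<psi> x))"
      using norm_triangle_ineq4[of "\<gamma> t - \<gamma> 0" "\<gamma> t - \<gamma> 0 - L (u t - \<psi> x)"] by simp
    also have "\<dots> \<le> (norm w + 1) * \<bar>t\<bar> + 1 / (2 * C) * norm (u t - \<psi> x)"
      using g l by (rule add_mono)
    finally have "C * norm (L (u t - \<psi> x)) \<le> C * ((norm w + 1) * \<bar>t\<bar> + 1 / (2 * C) * norm (u t - \<psi> x))"
      using \<open>C > 0\<close> by (intro mult_left_mono) auto
    also have "\<dots> = C * (norm w + 1) * \<bar>t\<bar> + norm (u t - \<psi> x) / 2"
      using \<open>C > 0\<close> by (simp add: field_simps)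
    finally show ?case
      using C[of "u t - \<psi> x"] by (simp add: K_def)
  qed
  have "w \<in> closure (range L)"
    unfolding closure_approachable
  proof (intro allI impI)
    fix \<epsilon> :: real assume "\<epsilon> > 0"
    have e1: "\<epsilon> / (4 * K) > 0" and e2: "\<epsilon> / 4 > 0"
      using \<open>\<epsilon> > 0\<close> \<open>K > 0\<close> by simp_all
    have "\<forall>\<^sub>F t in at (0::real). t \<noteq> 0" by (simp add: eventually_at_filter)
    then have "\<forall>\<^sub>F t in at 0. dist (L ((1 / t) *\<^sub>R (u t - \<psi> x))) w < \<epsilon>"
      using lin[OF e1] vel[OF e2] speed
    proof eventually_elim
      case (elim t)
      have "norm (L (u t - \<psi> x) - t *\<^sub>R w)
          \<le> norm (\<gamma> t - \<gamma> 0 - t *\<^sub>R w) + norm (\<gamma> t - \<gamma> 0 - L (u t - \<psi> x))"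
        using norm_triangle_ineq4[of "\<gamma> t - \<gamma> 0 - t *\<^sub>R w" "\<gamma> t - \<gamma> 0 - L (u t - \<psi> x)"] by simp
      also have "\<dots> \<le> \<epsilon> / 4 * \<bar>t\<bar> + \<epsilon> / (4 * K) * (K * \<bar>t\<bar>)"
      proof (rule add_mono)
        have "\<epsilon> / (4 * K) * norm (u t - \<psi> x) \<le> \<epsilon> / (4 * K) * (K * \<bar>t\<bar>)"
          using elim \<open>\<epsilon> > 0\<close> \<open>K > 0\<close> by (intro mult_left_mono) auto
        then show "norm (\<gamma> t - \<gamma> 0 - L (u t - \<psi> x)) \<le> \<epsilon> / (4 * K) * (K * \<bar>t\<bar>)"
          using elim by linarith
      qed (use elim in auto)
      also have "\<dots> = \<epsilon> / 2 * \<bar>t\<bar>" using \<open>K > 0\<close> by simp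
      finally have n: "norm (L (u t - \<psi> x) - t *\<^sub>R w) \<le> \<epsilon> / 2 * \<bar>t\<bar>" .
      have "L ((1 / t) *\<^sub>R (u t - \<psi> x)) - w = (1 / t) *\<^sub>R (L (u t - \<psi> x) - t *\<^sub>R w)"
        using elim(1) by (simp only: L.scaleR) (simp add: scaleR_diff_right)
      then have "dist (L ((1 / t) *\<^sub>R (u t - \<psi> x))) w = norm (L (u t - \<psi> x) - t *\<^sub>R w) / \<bar>t\<bar>"
        by (simp add: dist_norm)
      also have "\<dots> \<le> \<epsilon> / 2"
        using n elim by (simp add: field_simps)
      also have "\<dots> < \<epsilon>" using \<open>\<epsilon> > 0\<close> by simp
      finally show ?case .
    qed
    then have "\<exists>t. dist (L ((1 / t) *\<^sub>R (u t - \<psi> x))) w < \<epsilon>"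
      by (rule eventually_happens'[rotated]) simp
    then show "\<exists>y\<in>range L. dist y w < \<epsilon>" by blast
  qed
  then show ?thesis
    using cl by (simp add: tangent_image_def L_def x_def)
qed

text \<open>
  Near \<open>y\<close>, the line through \<open>y\<close> in direction \<open>v\<close> is projected to a curve in \<open>j(M)\<close>, with velocity
  \<open>proj_deriv j y v\<close>.
\<close>

lemma proj_deriv_in_tangent_image:
  assumes man: "hilbert_manifold A" and emb: "hilbert_embedding A j"
    and cl: "\<And>x. closed (range (differential A j x))"
    and y: "y \<in> proj_domain j"
  shows "proj_deriv j y v \<in> tangent_image A j (proj_onto j y)"
proof -
  let ?\<gamma> = "\<lambda>t. proj_onto j (y + t *\<^sub>R v)"
  have der: "(?\<gamma> has_vector_derivative proj_deriv j y v) (at 0)"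
  proof -
    have "((\<lambda>t::real. y + t *\<^sub>R v) has_derivative (\<lambda>t. t *\<^sub>R v)) (at 0)"
      by (auto intro!: derivative_eq_intros)
    moreover have "(proj_onto j has_derivative proj_deriv j y) (at (y + 0 *\<^sub>R v))"
      using proj_onto_has_derivative[OF y] by simp
    ultimately have "((\<lambda>t. proj_onto j (y + t *\<^sub>R v)) has_derivative (\<lambda>t. proj_deriv j y (t *\<^sub>R v))) (at 0)"
      by (rule has_derivative_compose)
    then show ?thesis
      by (simp add: has_vector_derivative_def blinfun.scaleR_right)
  qed
  have "((\<lambda>t::real. y + t *\<^sub>R v) \<longlongrightarrow> y + 0 *\<^sub>R v) (at 0)"
    by (intro tendsto_intros)
  then have "\<forall>\<^sub>F t in at (0::real). y + t *\<^sub>R v \<in> proj_domain j"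
    using y open_proj_domain[of j] by (intro topological_tendstoD) auto
  then have "\<forall>\<^sub>F t in at 0. ?\<gamma> t \<in> range j"
    by eventually_elim (rule proj_onto_in_range)
  from velocity_in_tangent_image[OF man emb cl der _ this]
  show ?thesis using proj_onto_in_range[OF y] by simp
qed

lemma sq_dist_has_derivative:
  assumes man: "hilbert_manifold A" and emb: "hilbert_embedding A j"
  shows "(local_rep (chart_at A p) (sq_dist j m0)
    has_derivative (\<lambda>v. 2 * inner (j p - j m0) (differential A j p v))) (at (snd (chart_at A p) p))"
proof -
  let ?\<phi> = "local_rep (chart_at A p) j"
  have "(?\<phi> has_derivative differential A j p) (at (snd (chart_at A p) p))"
    by (rule differential_has_derivative[OF man hilbert_embeddingD(2)[OF emb]])
  moreover have "?\<phi> (snd (chart_at A p) p) = j p"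
    by (rule local_rep_chart[OF man chart_at_mem[OF man]])
  ultimately have "((\<lambda>u. inner (?\<phi> u - j m0) (?\<phi> u - j m0))
    has_derivative (\<lambda>v. 2 * inner (j p - j m0) (differential A j p v))) (at (snd (chart_at A p) p))"
    by (auto intro!: derivative_eq_intros simp: inner_commute)
  moreover have "local_rep (chart_at A p) (sq_dist j m0) = (\<lambda>u. inner (?\<phi> u - j m0) (?\<phi> u - j m0))"
    by (simp add: local_rep_def sq_dist_def power2_norm_eq_inner fun_eq_iff)
  ultimately show ?thesis by simp
qed

lemma subspace_tangent_image:
  assumes "hilbert_manifold A" "hilbert_embedding A j"
  shows "subspace (tangent_image A j q)"
proof -
  interpret bounded_linear "differential A j (inv j q)"
    by (rule bounded_linear_differential[OF assms(1) hilbert_embeddingD(2)[OF assms(2)]])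
  show ?thesis
    unfolding tangent_image_def by (intro linear_subspace_image subspace_UNIV linear)
qed

lemma tangential_in_tangent_image:
  assumes "hilbert_manifold A" "hilbert_embedding A j" "closed (tangent_image A j q)"
    and "orthonormal_basis (e q) (tangent_image A j q)"
  shows "tangential e q v \<in> tangent_image A j q"
  using assms by (intro tangential_in subspace_tangent_image) auto

text \<open>
  The differential of \<open>sq_dist j m0\<close> at \<open>p\<close> is \<open>v \<mapsto> 2 * \<langle>j p - j m0, dj v\<rangle> = - 2 * \<langle>dj w, dj v\<rangle>\<close>. It
  vanishes on velocities of curves in the level set, hence \<open>w\<close> is normal, and it does not vanish
  identically, hence \<open>w \<noteq> 0\<close>.
\<close>

lemma normal_vector:
  assumes man: "hilbert_manifold A" and emb: "hilbert_embedding A j"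
    and reg: "regular_level A j m0 \<delta>" and p: "p \<in> bdry j m0 \<delta>"
    and w: "differential A j p w = tangential e (j p) (j m0 - j p)"
    and basis: "orthonormal_basis (e (j p)) (tangent_image A j (j p))"
  shows "w \<in> normal_space A j (bdry j m0 \<delta>) p" and "w \<noteq> 0"
proof -
  have inv: "inv j (j p) = p" using hilbert_embeddingD(1)[OF emb] by simp
  have inner_w: "inner (differential A j p w) (differential A j p v) = - inner (j p - j m0) (differential A j p v)" for v
    unfolding w by (subst inner_tangential[of e "j p", OF basis]) (simp_all add: tangent_image_def inv inner_diff_left)
  note der = sq_dist_has_derivative[OF man emb, of p m0]
  show "w \<in> normal_space A j (bdry j m0 \<delta>) p"
    unfolding normal_space_def tangent_inner_def
  proof (intro CollectI ballI)
    fix v assume "v \<in> tangent_to A (bdry j m0 \<delta>) p"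
    then obtain \<gamma> :: "real \<Rightarrow> _" where \<gamma>0: "\<gamma> 0 = p" and \<gamma>: "\<And>t. \<gamma> t \<in> bdry j m0 \<delta> \<inter> fst (chart_at A p)"
      and d\<gamma>: "((\<lambda>t. snd (chart_at A p) (\<gamma> t)) has_vector_derivative v) (at 0)"
      unfolding tangent_to_def mem_Collect_eq
      by (elim exE conjE) (rule that, assumption, erule spec, assumption)
    have der': "(local_rep (chart_at A p) (sq_dist j m0)
        has_derivative (\<lambda>v. 2 * inner (j p - j m0) (differential A j p v))) (at (snd (chart_at A p) (\<gamma> 0)))"
      using der by (simp only: \<gamma>0)
    have "((\<lambda>t. local_rep (chart_at A p) (sq_dist j m0) (snd (chart_at A p) (\<gamma> t)))
        has_derivative (\<lambda>t. 2 * inner (j p - j m0) (differential A j p (t *\<^sub>R v)))) (at 0)"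
      by (rule has_derivative_compose[OF d\<gamma>[unfolded has_vector_derivative_def] der'])
    moreover have "local_rep (chart_at A p) (sq_dist j m0) (snd (chart_at A p) (\<gamma> t)) = \<delta>\<^sup>2" for t
      using \<gamma>[of t] by (simp add: local_rep_chart[OF man] bdry_def)
    ultimately have "((\<lambda>t::real. \<delta>\<^sup>2) has_derivative (\<lambda>t. 2 * inner (j p - j m0) (differential A j p (t *\<^sub>R v)))) (at 0)"
      by simp
    then have "(\<lambda>t. 2 * inner (j p - j m0) (differential A j p (t *\<^sub>R v))) = (\<lambda>t. 0)"
      by (rule has_derivative_unique) (rule has_derivative_const)
    from fun_cong[OF this, of 1] show "inner (differential A j p w) (differential A j p v) = 0"
      by (simp add: inner_w)
  qed
  obtain v where "differential A (sq_dist j m0) p v \<noteq> 0"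
    using reg p by (auto simp: regular_level_def)
  moreover have "differential A (sq_dist j m0) p = (\<lambda>v. 2 * inner (j p - j m0) (differential A j p v))"
    unfolding differential_def[of A "sq_dist j m0"] using frechet_derivative_at[OF der] by simp
  ultimately have "inner (differential A j p w) (differential A j p v) \<noteq> 0"
    by (simp add: inner_w)
  moreover have "differential A j p 0 = 0"
    using linear_0[OF bounded_linear.linear[OF bounded_linear_differential[OF man hilbert_embeddingD(2)[OF emb]]]] .
  ultimately show "w \<noteq> 0" by auto
qed

section \<open>Extrinsic mean and extrinsic covariance\<close>

lemma (in prob_space) expectation_sq_dist:
  fixes Y :: "'a \<Rightarrow> 'h::{real_inner, banach, second_countable_topology}"
  assumes rv[measurable]: "random_variable borel Y" and Y2: "integrable M (\<lambda>\<omega>. (norm (Y \<omega>))\<^sup>2)"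
  shows "expectation (\<lambda>\<omega>. (norm (Y \<omega> - a))\<^sup>2)
    = expectation (\<lambda>\<omega>. (norm (Y \<omega> - expectation Y))\<^sup>2) + (norm (expectation Y - a))\<^sup>2"
proof -
  let ?\<mu> = "expectation Y"
  note int = integrable_of_square_integrable[OF rv Y2]
  have "(norm (Y \<omega> - a))\<^sup>2 = (norm (Y \<omega> - ?\<mu>))\<^sup>2 + inner (Y \<omega> - ?\<mu>) (2 *\<^sub>R (?\<mu> - a)) + (norm (?\<mu> - a))\<^sup>2" for \<omega>
    by (simp add: power2_norm_eq_inner algebra_simps inner_diff_left inner_diff_right inner_commute)
  moreover have "expectation (\<lambda>\<omega>. inner (Y \<omega> - ?\<mu>) (2 *\<^sub>R (?\<mu> - a))) = 0"
  proof -
    have "expectation (\<lambda>\<omega>. Y \<omega> - ?\<mu>) = 0"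
      by (subst Bochner_Integration.integral_diff) (simp_all add: int prob_space)
    moreover have "expectation (\<lambda>\<omega>. inner (Y \<omega> - ?\<mu>) (2 *\<^sub>R (?\<mu> - a))) = inner (expectation (\<lambda>\<omega>. Y \<omega> - ?\<mu>)) (2 *\<^sub>R (?\<mu> - a))"
      by (rule integral_inner_left) (simp add: int)
    ultimately show ?thesis by simp
  qed
  moreover have "integrable M (\<lambda>\<omega>. inner (Y \<omega> - ?\<mu>) (2 *\<^sub>R (?\<mu> - a)))"
    by (intro integrable_inner_left Bochner_Integration.integrable_diff int) simp
  moreover note square_integrable_centered[OF rv Y2, of ?\<mu>]
  ultimately show ?thesis
    by (simp only: Bochner_Integration.integral_add Bochner_Integration.integrable_add integrable_const)
      (simp add: prob_space)
qed

text \<open>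
  By \<open>expectation_sq_dist\<close>, minimising the expected squared distance amounts to minimising the
  distance from the mean vector.
\<close>

lemma extrinsic_mean_eq:
  fixes j :: "'m \<Rightarrow> 'h::{real_inner, banach, second_countable_topology}"
  assumes prob: "prob_space P" and rv: "(\<lambda>\<omega>. j (X \<omega>)) \<in> borel_measurable P"
    and sq: "integrable P (\<lambda>\<omega>. (norm (j (X \<omega>)))\<^sup>2)"
    and nonfocal: "nonfocal P j X" and inj: "inj j"
  shows "j (extrinsic_mean P j X) = proj_onto j (mean_vector P j X)"
proof -
  let ?\<mu> = "mean_vector P j X"
  have un: "\<exists>!q. q \<in> nearest_points j ?\<mu>" using nonfocal by (simp add: nonfocal_def)
  note near = proj_onto_nearest[OF un]
  then obtain x where x: "proj_onto j ?\<mu> = j x" by (auto simp: nearest_points_def)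
  have E: "(\<integral>\<omega>. (norm (j (X \<omega>) - j z))\<^sup>2 \<partial>P) = (\<integral>\<omega>. (norm (j (X \<omega>) - ?\<mu>))\<^sup>2 \<partial>P) + (norm (?\<mu> - j z))\<^sup>2" for z
    unfolding mean_vector_def by (rule prob_space.expectation_sq_dist[OF prob rv sq])
  have min_iff: "(\<forall>z'. (\<integral>\<omega>. (norm (j (X \<omega>) - j z))\<^sup>2 \<partial>P) \<le> (\<integral>\<omega>. (norm (j (X \<omega>) - j z'))\<^sup>2 \<partial>P))
      \<longleftrightarrow> j z \<in> nearest_points j ?\<mu>" for z
    unfolding E nearest_points_def by simp
  have "extrinsic_mean P j X = x"
    unfolding extrinsic_mean_def min_iff
  proof (rule the_equality)
    show "j x \<in> nearest_points j ?\<mu>" using near x by simp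
    show "z = x" if "j z \<in> nearest_points j ?\<mu>" for z
      using un that near x inj by (metis injD)
  qed
  then show ?thesis using x by simp
qed

lemma differential_inv_differential:
  "u \<in> tangent_image A j (j x) \<Longrightarrow> inj j \<Longrightarrow> differential A j x (inv (differential A j x) u) = u"
  by (simp add: tangent_image_def f_inv_into_f)

text \<open>
  With \<open>D\<close> the differential of the projection at \<open>\<mu>\<close>, \<open>Z = j X - \<mu>\<close> and \<open>w = dj v\<close>, the matrix of
  the operator has the entries \<open>E \<langle>D Z, e a\<rangle> \<langle>D Z, e a'\<rangle>\<close>. Adjoints are avoided by the vectors
  \<open>u y = E \<langle>D Z, y\<rangle> Z\<close>, in terms of which the matrix products are expansions in the ambient basis:
  the first product has entries \<open>\<langle>h c, u (e a)\<rangle>\<close>, the second \<open>\<langle>D (u (e a)), e a'\<rangle>\<close>. Expanding \<open>w\<close> in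
  the tangent basis, the operator maps \<open>v\<close> to the preimage \<open>k\<close> of \<open>D (u w)\<close> under \<open>dj\<close>. The series
  defining it converges in the model space because \<open>dj\<close> is bounded below.
\<close>

lemma extrinsic_cov_quadratic_form:
  fixes A :: "('m::{metric_space, second_countable_topology},
               'c::{real_inner, banach, second_countable_topology}) chart set"
    and j :: "'m \<Rightarrow> 'h::{real_inner, banach, second_countable_topology}"
  assumes man: "hilbert_manifold A" and emb: "hilbert_embedding A j"
    and cl: "\<And>x. closed (range (differential A j x))"
    and tangent_basis: "\<And>q. q \<in> range j \<Longrightarrow> orthonormal_basis (e q) (tangent_image A j q)"
    and ambient_basis: "orthonormal_basis h UNIV"
    and prob: "prob_space P" and rv[measurable]: "(\<lambda>\<omega>. j (X \<omega>)) \<in> borel_measurable P"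
    and sq: "integrable P (\<lambda>\<omega>. (norm (j (X \<omega>)))\<^sup>2)"
    and nonfocal: "nonfocal P j X" and dom: "mean_vector P j X \<in> proj_domain j"
  defines "p \<equiv> extrinsic_mean P j X" and "\<mu> \<equiv> mean_vector P j X"
  shows "tangent_inner A j p v (extrinsic_cov A P j X e h v)
    = (\<integral>\<omega>. (inner (proj_deriv j \<mu> (j (X \<omega>) - \<mu>)) (differential A j p v))\<^sup>2 \<partial>P)"
proof -
  interpret prob_space P by fact
  define q where "q = proj_onto j \<mu>"
  define D where "D = blinfun_apply (proj_deriv j \<mu>)"
  define Z where "Z \<omega> = j (X \<omega>) - \<mu>" for \<omega>
  define w where "w = differential A j p v"
  define f where "f a = inv (differential A j p) (e q a)" for a
  define C where "C = cov_operator P j X"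
  note injj = hilbert_embeddingD(1)[OF emb]
  have jp: "j p = q"
    unfolding p_def q_def \<mu>_def by (rule extrinsic_mean_eq[OF prob rv sq nonfocal injj])
  have qr: "q \<in> range j" using jp by auto
  interpret D: bounded_linear D unfolding D_def by (rule blinfun.bounded_linear_right)
  interpret dj: bounded_linear "differential A j p"
    by (rule bounded_linear_differential[OF man hilbert_embeddingD(2)[OF emb]])
  have Z_rv[measurable]: "Z \<in> borel_measurable P" unfolding Z_def by measurable
  have Z2: "integrable P (\<lambda>\<omega>. (norm (Z \<omega>))\<^sup>2)"
    unfolding Z_def by (rule square_integrable_centered[OF rv sq])
  have D_meas[measurable]: "D \<in> borel_measurable borel"
    by (intro borel_measurable_continuous_onI D.continuous_on continuous_on_id)
  obtain KD where "KD > 0" and KD: "\<And>x. norm (D x) \<le> norm x * KD"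
    using D.pos_bounded by blast
  have DT: "D x \<in> tangent_image A j (j p)" for x
    unfolding jp q_def D_def by (rule proj_deriv_in_tangent_image[OF man emb cl]) (use dom in \<open>simp add: \<mu>_def\<close>)
  have wT: "w \<in> tangent_image A j (j p)"
    using injj by (simp add: tangent_image_def w_def)
  have basis: "orthonormal_basis (e q) (tangent_image A j (j p))"
    using tangent_basis[OF qr] jp by simp
  have eT: "e q a \<in> tangent_image A j (j p)" for a
    using basis by (auto simp: orthonormal_basis_def)
  have djf: "differential A j p (f a) = e q a" for a
    unfolding f_def by (rule differential_inv_differential[OF eT injj])
  have intW: "integrable P (\<lambda>\<omega>. g (Z \<omega>) *\<^sub>R Z \<omega>)" if g: "bounded_linear g" for g :: "'h \<Rightarrow> real"
  proof -
    interpret g: bounded_linear g by fact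
    obtain Kg where Kg: "\<And>x. norm (g x) \<le> norm x * Kg" using g.pos_bounded by blast
    have [measurable]: "g \<in> borel_measurable borel"
      by (intro borel_measurable_continuous_onI g.continuous_on continuous_on_id)
    show ?thesis
    proof (rule Bochner_Integration.integrable_bound)
      show "integrable P (\<lambda>\<omega>. Kg * (norm (Z \<omega>))\<^sup>2)" using Z2 by simp
      have "norm (g z *\<^sub>R z) \<le> Kg * (norm z)\<^sup>2" for z
        using mult_right_mono[OF Kg[of z], of "norm z"] by (simp add: power2_eq_square mult_ac)
      then show "AE \<omega> in P. norm (g (Z \<omega>) *\<^sub>R Z \<omega>) \<le> norm (Kg * (norm (Z \<omega>))\<^sup>2)"
        by (intro AE_I2) (simp add: order_trans[OF _ abs_ge_self])
    qed measurable
  qed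
  define u where "u y = (\<integral>\<omega>. inner (D (Z \<omega>)) y *\<^sub>R Z \<omega> \<partial>P)" for y
  have blD: "bounded_linear (\<lambda>x. inner (D x) y)" for y
    by (rule bounded_linear_compose[OF bounded_linear_inner_left D.bounded_linear_axioms])
  have gu: "g (u y) = (\<integral>\<omega>. inner (D (Z \<omega>)) y * g (Z \<omega>) \<partial>P)" if "bounded_linear g" for g :: "'h \<Rightarrow> real" and y
    unfolding u_def
    by (subst integral_bounded_linear[OF that intW[OF blD], symmetric])
      (simp add: linear_scale[OF bounded_linear.linear[OF that]])
  have gC: "g (C y) = (\<integral>\<omega>. inner y (Z \<omega>) * g (Z \<omega>) \<partial>P)" if "bounded_linear g" for g :: "'h \<Rightarrow> real" and y
    unfolding C_def cov_operator_def tensor_square_def \<mu>_def[symmetric] Z_def[symmetric]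
    by (subst integral_bounded_linear[OF that intW[OF bounded_linear_inner_right], symmetric])
      (simp add: linear_scale[OF bounded_linear.linear[OF that]])
  have expand: "(\<lambda>b. inner (h b) x * g (h b)) sums g x" if "bounded_linear g" for g :: "'h \<Rightarrow> real" and x
  proof -
    have "(\<lambda>b. g (inner (h b) x *\<^sub>R h b)) sums g x"
      by (rule bounded_linear.sums[OF that orthonormal_basis_sums[OF ambient_basis UNIV_I]])
    then show ?thesis by (simp add: linear_scale[OF bounded_linear.linear[OF that]])
  qed
  define B where "B = proj_matrix P j X e h"
  have B: "B a b = inner (D (h b)) (e q a)" for a b
    unfolding B_def proj_matrix_def Let_def \<mu>_def[symmetric] q_def D_def
    using frechet_derivative_proj_onto[OF dom] by (simp add: \<mu>_def)
  have BC: "inf_mat_mult B (cov_matrix P j X h) a c = inner (h c) (u (e q a))" for a c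
  proof -
    have "(\<lambda>b. inner (h b) (C (h c)) * inner (D (h b)) (e q a)) sums inner (D (C (h c))) (e q a)"
      by (rule expand[OF blD])
    then have "inf_mat_mult B (cov_matrix P j X h) a c = inner (D (C (h c))) (e q a)"
      unfolding inf_mat_mult_def B cov_matrix_def C_def[symmetric]
      by (simp add: sums_iff mult.commute)
    also have "\<dots> = inner (h c) (u (e q a))"
      unfolding gC[OF blD] gu[OF bounded_linear_inner_right] by (simp add: mult.commute)
    finally show ?thesis .
  qed
  define H where "H = inf_mat_mult (inf_mat_mult B (cov_matrix P j X h)) (inf_mat_transpose B)"
  have H: "H a a' = inner (D (u (e q a))) (e q a')" for a a'
    unfolding H_def inf_mat_mult_def[of "inf_mat_mult _ _"] BC inf_mat_transpose_def B
    using expand[OF blD] by (simp add: sums_iff)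
  have inner_sum: "(\<lambda>a. inner x (e q a) * inner (e q a) y) sums inner x y" if "y \<in> tangent_image A j (j p)" for x y
    using bounded_linear.sums[OF bounded_linear_inner_right orthonormal_basis_sums[OF basis that], of x]
    by (simp add: mult.commute)
  define k where "k = inv (differential A j p) (D (u w))"
  have djk: "differential A j p k = D (u w)"
    unfolding k_def by (rule differential_inv_differential[OF DT injj])
  have row: "(\<Sum>a'. H a a' * tangent_inner A j p (f a') v) = inner (e q a) (D (u w))" for a
  proof -
    have "(\<lambda>a'. H a a' * tangent_inner A j p (f a') v) sums inner (D (u (e q a))) w"
      unfolding H tangent_inner_def djf w_def[symmetric] by (rule inner_sum[OF wT])
    moreover have "inner (D (u (e q a))) w = inner (D (u w)) (e q a)"
      unfolding gu[OF blD] by (simp add: mult.commute)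
    ultimately show ?thesis by (simp add: sums_iff inner_commute)
  qed
  have "(\<lambda>a. inner (e q a) (D (u w)) *\<^sub>R f a) sums k"
  proof -
    obtain c where c: "\<And>v. norm v \<le> c * norm (differential A j p v)"
      using differential_bounded_below[OF man emb cl] by blast
    have "(\<lambda>n. \<Sum>a<n. inner (e q a) (D (u w)) *\<^sub>R e q a) \<longlonglongrightarrow> D (u w)"
      using orthonormal_basis_sums[OF basis DT] by (simp add: sums_def)
    then have lim: "(\<lambda>n. c * norm ((\<Sum>a<n. inner (e q a) (D (u w)) *\<^sub>R e q a) - D (u w))) \<longlonglongrightarrow> 0"
      by (intro tendsto_mult_right_zero tendsto_norm_zero) (simp add: LIM_zero_iff)
    have bound: "norm ((\<Sum>a<n. inner (e q a) (D (u w)) *\<^sub>R f a) - k)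
        \<le> c * norm ((\<Sum>a<n. inner (e q a) (D (u w)) *\<^sub>R e q a) - D (u w))" for n
      using c[of "(\<Sum>a<n. inner (e q a) (D (u w)) *\<^sub>R f a) - k"]
      by (simp only: dj.diff dj.sum dj.scaleR djf djk)
    have "(\<lambda>n. (\<Sum>a<n. inner (e q a) (D (u w)) *\<^sub>R f a) - k) \<longlonglongrightarrow> 0"
    proof (rule Lim_null_comparison[OF _ lim])
      show "\<forall>\<^sub>F n in sequentially. norm ((\<Sum>a<n. inner (e q a) (D (u w)) *\<^sub>R f a) - k)
        \<le> c * norm ((\<Sum>a<n. inner (e q a) (D (u w)) *\<^sub>R e q a) - D (u w))"
        by (rule always_eventually) (rule allI, rule bound)
    qed
    then show ?thesis by (simp add: sums_def LIM_zero_iff)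
  qed
  then have "extrinsic_cov A P j X e h v = k"
    unfolding extrinsic_cov_def Let_def
    unfolding p_def[symmetric] \<mu>_def[symmetric] q_def[symmetric] B_def[symmetric] H_def[symmetric] f_def[symmetric] row
    by (simp add: sums_iff)
  then have "tangent_inner A j p v (extrinsic_cov A P j X e h v) = inner (D (u w)) w"
    by (simp add: tangent_inner_def djk w_def[symmetric] inner_commute)
  also have "\<dots> = (\<integral>\<omega>. (inner (D (Z \<omega>)) w)\<^sup>2 \<partial>P)"
    unfolding gu[OF blD] by (simp add: power2_eq_square)
  finally show ?thesis by (simp add: D_def Z_def w_def)
qed

section \<open>The test statistic\<close>

text \<open>
  The derivative \<open>v \<mapsto> 2 * \<langle>\<pi> y - j m0, d\<pi> v\<rangle>\<close> of \<open>y \<mapsto> \<parallel>\<pi> y - j m0\<parallel>\<^sup>2\<close>, with \<open>\<pi>\<close> the projection onto \<open>j(M)\<close>.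
\<close>

definition sq_dist_proj_deriv :: "('m \<Rightarrow> 'h::real_inner) \<Rightarrow> 'm \<Rightarrow> 'h \<Rightarrow> 'h \<Rightarrow>\<^sub>L real" where
  "sq_dist_proj_deriv j m0 y = (2 *\<^sub>R blinfun_inner_left (proj_onto j y - j m0)) o\<^sub>L proj_deriv j y"

lemma sq_dist_proj_deriv_apply:
  "sq_dist_proj_deriv j m0 y v = 2 * inner (proj_deriv j y v) (proj_onto j y - j m0)"
  by (simp add: sq_dist_proj_deriv_def blinfun.scaleR_left)

lemma sq_dist_proj_has_derivative:
  assumes "y \<in> proj_domain j"
  shows "((\<lambda>y. (norm (proj_onto j y - j m0))\<^sup>2) has_derivative sq_dist_proj_deriv j m0 y) (at y)"
  unfolding power2_norm_eq_inner
  using proj_onto_has_derivative[OF assms]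
  by (auto intro!: derivative_eq_intros simp: inner_commute sq_dist_proj_deriv_apply)

lemma isCont_sq_dist_proj_deriv:
  "y \<in> proj_domain j \<Longrightarrow> isCont (sq_dist_proj_deriv j m0) y"
  unfolding sq_dist_proj_deriv_def
  using isCont_proj_onto[of y j] isCont_proj_deriv[of y j]
  unfolding isCont_def
  by (intro bounded_bilinear.tendsto[OF bounded_bilinear_blinfun_compose]
      tendsto_scaleR bounded_linear.tendsto[OF bounded_linear_blinfun_inner_left] tendsto_diff tendsto_const)

lemma sample_mean_vector_eq_average: "sample_mean_vector j n x = average (\<lambda>i. j (x i)) n"
  by (simp add: sample_mean_vector_def average_def)

lemma extrinsic_sample_mean_proj:
  "sample_mean_vector j n x \<in> proj_domain j \<Longrightarrow>
    j (extrinsic_sample_mean j n x) = proj_onto j (sample_mean_vector j n x)"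
  unfolding extrinsic_sample_mean_def by (rule f_inv_into_f[OF proj_onto_in_range])

text \<open>
  The vector \<open>proj_deriv j y v\<close> is tangent, so its scalar product with \<open>j m0 - \<pi> y\<close> is the same as
  with the tangential component of \<open>j m0 - \<pi> y\<close>.
\<close>

lemma inner_tangential_proj_deriv:
  assumes man: "hilbert_manifold A" and emb: "hilbert_embedding A j"
    and cl: "\<And>x. closed (range (differential A j x))"
    and basis: "orthonormal_basis (e (proj_onto j y)) (tangent_image A j (proj_onto j y))"
    and y: "y \<in> proj_domain j"
  shows "inner (tangential e (proj_onto j y) (j m0 - proj_onto j y)) (proj_deriv j y v)
    = - sq_dist_proj_deriv j m0 y v / 2"
  using proj_deriv_in_tangent_image[OF man emb cl y, of v]
  by (subst inner_tangential[of e "proj_onto j y", OF basis])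
    (simp_all add: sq_dist_proj_deriv_apply inner_commute inner_diff_left inner_diff_right field_simps)

text \<open>
  The studentizer is the plug-in estimator of the standard deviation in the delta method. Of the
  two tangential components in its definition, the one of the increment disappears because it is
  paired with a tangent vector, the other one by \<open>inner_tangential_proj_deriv\<close>.
\<close>

lemma sample_var_eq:
  fixes A :: "('m::{metric_space, second_countable_topology},
               'c::{real_inner, banach, second_countable_topology}) chart set"
    and j :: "'m \<Rightarrow> 'h::{real_inner, banach, second_countable_topology}"
  assumes man: "hilbert_manifold A" and emb: "hilbert_embedding A j"
    and cl: "\<And>x. closed (range (differential A j x))"
    and tangent_basis: "\<And>q. q \<in> range j \<Longrightarrow> orthonormal_basis (e q) (tangent_image A j q)"
    and dom: "sample_mean_vector j n x \<in> proj_domain j"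
  defines "y \<equiv> sample_mean_vector j n x"
  shows "sqrt (sample_var A j e m0 n x) = rms (\<lambda>i. sq_dist_proj_deriv j m0 y (j (x i) - y)) n"
proof -
  note injj = hilbert_embeddingD(1)[OF emb]
  define p where "p = extrinsic_sample_mean j n x"
  have jp: "j p = proj_onto j y"
    unfolding p_def y_def by (rule extrinsic_sample_mean_proj[OF dom])
  have basis: "orthonormal_basis (e (j p)) (tangent_image A j (j p))"
    by (rule tangent_basis) simp
  define w where "w = tangential e (j p) (j m0 - j p)"
  have wT: "w \<in> tangent_image A j (j p)"
    unfolding w_def
    by (rule tangential_in_tangent_image[of A j "j p" e, OF man emb _ basis]) (use cl in \<open>simp add: tangent_image_def\<close>)
  have w: "differential A j p (nu_hat A j e m0 n x) = w"
    unfolding nu_hat_def Let_def p_def[symmetric] w_def[symmetric]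
    by (rule differential_inv_differential[OF wT injj])
  have inner_w: "inner w (tangential e (j p) (proj_deriv j y v)) = - sq_dist_proj_deriv j m0 y v / 2" for v
  proof -
    have "inner w (tangential e (j p) (proj_deriv j y v)) = inner w (proj_deriv j y v)"
      unfolding inner_commute[of w] by (rule inner_tangential[of e "j p", OF basis wT])
    also have "\<dots> = - sq_dist_proj_deriv j m0 y v / 2"
      using inner_tangential_proj_deriv[of A j e, OF man emb cl basis[unfolded jp] dom[folded y_def]]
      by (simp add: w_def jp)
    finally show ?thesis .
  qed
  have "sample_var A j e m0 n x = (1 / real n) * (\<Sum>i<n. (sq_dist_proj_deriv j m0 y (j (x i) - y))\<^sup>2)"
    unfolding sample_var_def extrinsic_sample_cov_def Let_def tensor_square_def
    unfolding p_def[symmetric] w y_def[symmetric] frechet_derivative_proj_onto[OF dom[folded y_def]]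
    by (simp add: inner_sum_right inner_w sum_distrib_left power2_eq_square)
  then show ?thesis by (simp add: rms_def)
qed

theorem theorem2p2:
  fixes A :: "('m::{metric_space, second_countable_topology},
               'c::{real_inner, banach, second_countable_topology}) chart set"
    and j :: "'m \<Rightarrow> 'h::{real_inner, banach, second_countable_topology}"
    and P :: "'w measure" and X :: "'w \<Rightarrow> 'm" and Xs :: "nat \<Rightarrow> 'w \<Rightarrow> 'm"
    and e :: "'h \<Rightarrow> nat \<Rightarrow> 'h" and h :: "nat \<Rightarrow> 'h"
    and m0 :: 'm and \<delta> :: real
  assumes ambient: "infinite_dimensional TYPE('h)"
    and manifold: "hilbert_manifold A"
    and embedding: "hilbert_embedding A j"
    and closed_tangent: "\<And>x. closed (range (differential A j x))"
    and tangent_basis: "\<And>q. q \<in> range j \<Longrightarrow> orthonormal_basis (e q) (tangent_image A j q)"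
    and ambient_basis: "orthonormal_basis h UNIV"
    and prob: "prob_space P"
    and random_object: "X \<in> borel_measurable P"
    and independent: "prob_space.indep_vars P (\<lambda>_. borel) Xs UNIV"
    and identically_distributed: "\<And>i. distr P borel (Xs i) = distr P borel X"
    and second_moment: "integrable P (\<lambda>\<omega>. (norm (j (X \<omega>)))\<^sup>2)"
    and nonfocal: "nonfocal P j X"
    and proj_C1: "mean_vector P j X \<in> proj_domain j"
    and delta_pos: "\<delta> > 0"
    and regular: "regular_level A j m0 \<delta>"
    and H0: "extrinsic_mean P j X \<in> null_region A P j X e h m0 \<delta>"
    and H0_boundary: "extrinsic_mean P j X \<in> bdry_pd A P j X e h m0 \<delta>"
  shows "(\<forall>n. (\<lambda>\<omega>. test_statistic A j e m0 \<delta> n (\<lambda>i. Xs i \<omega>)) \<in> borel_measurable P) \<and>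
         weak_conv_m
           (\<lambda>n. distr P borel (\<lambda>\<omega>. test_statistic A j e m0 \<delta> n (\<lambda>i. Xs i \<omega>)))
           std_normal_distribution"
proof -
  interpret prob_space P by (rule prob)
  note injj = hilbert_embeddingD(1)[OF embedding]
  note cont_j = continuous_on_embedding[OF embedding]
  have j_meas[measurable]: "j \<in> borel_measurable borel"
    by (rule borel_measurable_continuous_onI[OF cont_j])
  define Y where "Y i \<omega> = j (Xs i \<omega>)" for i \<omega>
  define \<mu> where "\<mu> = mean_vector P j X"
  define U where "U = proj_domain j"
  define G where "G y = (norm (proj_onto j y - j m0))\<^sup>2" for y
  define l where "l = sq_dist_proj_deriv j m0"
  define p where "p = extrinsic_mean P j X"
  define T where "T n \<omega> = test_statistic A j e m0 \<delta> n (\<lambda>i. Xs i \<omega>)" for n \<omega>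
  have Xs_rv[measurable]: "random_variable borel (Xs i)" for i
    using independent by (simp add: indep_vars_def)
  have Y_rv[measurable]: "random_variable borel (Y i)" for i
    unfolding Y_def by measurable
  have jX_rv[measurable]: "random_variable borel (\<lambda>\<omega>. j (X \<omega>))"
    using random_object by measurable
  have Y_indep: "indep_vars (\<lambda>_. borel) Y UNIV"
    unfolding Y_def[abs_def] by (rule indep_vars_compose2[OF independent]) simp
  have Y_X: "distr P borel (Y i) = distr P borel (\<lambda>\<omega>. j (X \<omega>))" for i
  proof -
    have "distr P borel (Y i) = distr (distr P borel (Xs i)) borel j"
      by (subst distr_distr[OF j_meas Xs_rv]) (simp add: Y_def[abs_def] comp_def)
    also have "\<dots> = distr (distr P borel X) borel j"
      by (simp only: identically_distributed)
    also have "\<dots> = distr P borel (\<lambda>\<omega>. j (X \<omega>))"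
      by (subst distr_distr[OF j_meas random_object]) (simp add: comp_def)
    finally show ?thesis .
  qed
  have Y_ident: "distr P borel (Y i) = distr P borel (Y 0)" for i
    by (simp only: Y_X)
  note same = identically_distributed_expectation[OF Y_rv jX_rv _ Y_X]
  have Y2: "integrable P (\<lambda>\<omega>. (norm (Y 0 \<omega>))\<^sup>2)"
    using same(1)[of "\<lambda>y. (norm y)\<^sup>2" 0] second_moment by simp
  have \<mu>: "\<mu> = expectation (Y 0)"
    using same(2)[of "\<lambda>y. y" 0] by (simp add: \<mu>_def mean_vector_def)
  have \<mu>U: "\<mu> \<in> U" using proj_C1 by (simp add: \<mu>_def U_def)
  have jp: "j p = proj_onto j \<mu>"
    unfolding p_def \<mu>_def by (rule extrinsic_mean_eq[OF prob jX_rv second_moment nonfocal injj])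
  have pd: "p \<in> bdry_pd A P j X e h m0 \<delta>" and p_bdry: "p \<in> bdry j m0 \<delta>"
    using H0_boundary by (simp_all add: p_def bdry_pd_def)
  have G\<mu>: "G \<mu> = \<delta>\<^sup>2"
    using p_bdry by (simp add: G_def bdry_def sq_dist_def jp)
  \<comment> \<open>the statistic as a function of the vectors \<open>Y i\<close> alone\<close>
  have T_eq: "T n \<omega> = (if average (\<lambda>i. Y i \<omega>) n \<in> U
      then sqrt (real n) * (G (average (\<lambda>i. Y i \<omega>) n) - \<delta>\<^sup>2)
        / rms (\<lambda>i. l (average (\<lambda>i. Y i \<omega>) n) (Y i \<omega> - average (\<lambda>i. Y i \<omega>) n)) n else 0)" for n \<omega>
  proof (cases "sample_mean_vector j n (\<lambda>i. Xs i \<omega>) \<in> proj_domain j")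
    case True
    from sample_var_eq[of A j e, OF manifold embedding closed_tangent tangent_basis True]
    show ?thesis
      using True extrinsic_sample_mean_proj[OF True]
      by (simp add: T_def test_statistic_def sample_mean_vector_eq_average Y_def U_def G_def l_def sq_dist_def)
  next
    case False
    then show ?thesis
      by (simp add: T_def test_statistic_def sample_mean_vector_eq_average Y_def U_def)
  qed
  have openU: "open U" unfolding U_def by (rule open_proj_domain)
  have U_meas[measurable]: "U \<in> sets borel" using openU by (rule borel_open)
  have T_meas: "random_variable borel (T n)" for n
  proof -
    define y where "y \<omega> = average (\<lambda>i. Y i \<omega>) n" for \<omega>
    \<comment> \<open>\<open>G\<close> and \<open>l\<close> are continuous on the open set \<open>U\<close> only; extended by \<open>0\<close> they are Borel functions\<close>
    define g1 where "g1 z = indicator U z *\<^sub>R G z" for z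
    define g2 where "g2 z = indicator (U \<times> UNIV) z *\<^sub>R l (fst z) (snd z)" for z :: "'h \<times> 'h"
    have contG: "continuous_on U G"
      unfolding G_def
      by (intro continuous_intros continuous_at_imp_continuous_on ballI isCont_proj_onto) (simp add: U_def)
    have contl: "continuous_on U l"
      unfolding l_def by (intro continuous_at_imp_continuous_on ballI isCont_sq_dist_proj_deriv) (simp add: U_def)
    have [measurable]: "g1 \<in> borel_measurable borel"
      unfolding g1_def by (rule borel_measurable_continuous_on_indicator[OF U_meas contG])
    have "continuous_on (U \<times> UNIV) (\<lambda>z. l (fst z))"
      by (rule continuous_on_compose2[OF contl continuous_on_fst[OF continuous_on_id]]) auto
    then have "continuous_on (U \<times> UNIV) (\<lambda>z. l (fst z) (snd z))"
      by (intro bounded_bilinear.continuous_on[OF bounded_bilinear_blinfun_apply]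
          continuous_on_snd continuous_on_id)
    then have g2_meas: "g2 \<in> borel_measurable borel"
      unfolding g2_def
      by (intro borel_measurable_continuous_on_indicator borel_open open_Times openU open_UNIV)
    have [measurable]: "y \<in> borel_measurable P"
      unfolding y_def average_def by measurable
    have [measurable]: "(\<lambda>\<omega>. g2 (y \<omega>, Y i \<omega> - y \<omega>)) \<in> borel_measurable P" for i
      by (rule measurable_compose[OF _ g2_meas]) (intro borel_measurable_Pair; measurable)
    have "T n = (\<lambda>\<omega>. if y \<omega> \<in> U then sqrt (real n) * (g1 (y \<omega>) - \<delta>\<^sup>2)
        / sqrt (1 / real n * (\<Sum>i<n. (g2 (y \<omega>, Y i \<omega> - y \<omega>))\<^sup>2)) else 0)"
      by (rule ext) (simp add: T_eq rms_def g1_def g2_def flip: y_def)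
    then show ?thesis
      by (simp only:) measurable
  qed
  have tb: "orthonormal_basis (e (j p)) (tangent_image A j (j p))"
    by (rule tangent_basis) simp
  have pos: "expectation (\<lambda>\<omega>. (l \<mu> (Y 0 \<omega> - \<mu>))\<^sup>2) > 0"
  proof -
    define \<nu> where "\<nu> = inv (differential A j p) (tangential e (j p) (j m0 - j p))"
    have \<nu>: "differential A j p \<nu> = tangential e (j p) (j m0 - j p)"
      unfolding \<nu>_def
      by (rule differential_inv_differential[OF tangential_in_tangent_image[of A j "j p" e,
            OF manifold embedding _ tb] injj]) (simp add: tangent_image_def closed_tangent)
    have l_eq: "inner (proj_deriv j \<mu> v) (differential A j p \<nu>) = - l \<mu> v / 2" for v
      unfolding \<nu> jp l_def inner_commute[of "blinfun_apply _ _"]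
      by (rule inner_tangential_proj_deriv[of A j e, OF manifold embedding closed_tangent tb[unfolded jp]])
        (use \<mu>U in \<open>simp add: U_def\<close>)
    have "0 < tangent_inner A j p \<nu> (extrinsic_cov A P j X e h \<nu>)"
      using pd normal_vector[of A j m0 \<delta> p \<nu> e, OF manifold embedding regular p_bdry \<nu> tb]
      by (simp add: bdry_pd_def)
    also have "\<dots> = expectation (\<lambda>\<omega>. (inner (proj_deriv j \<mu> (j (X \<omega>) - \<mu>)) (differential A j p \<nu>))\<^sup>2)"
      unfolding p_def \<mu>_def
      by (rule extrinsic_cov_quadratic_form[of A j e, OF manifold embedding closed_tangent tangent_basis
            ambient_basis prob jX_rv second_moment nonfocal proj_C1])
    also have "\<dots> = expectation (\<lambda>\<omega>. (l \<mu> (j (X \<omega>) - \<mu>))\<^sup>2) / 4"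
      unfolding l_eq by (simp add: power_divide)
    also have "expectation (\<lambda>\<omega>. (l \<mu> (j (X \<omega>) - \<mu>))\<^sup>2) = expectation (\<lambda>\<omega>. (l \<mu> (Y 0 \<omega> - \<mu>))\<^sup>2)"
    proof -
      have "(\<lambda>y. (l \<mu> (y - \<mu>))\<^sup>2) \<in> borel_measurable borel"
        by (intro borel_measurable_continuous_onI continuous_intros)
      from same(2)[OF this, of 0] show ?thesis by simp
    qed
    finally show ?thesis by simp
  qed
  have "weak_conv_m (\<lambda>n. distr P borel (T n)) std_normal_distribution"
  proof (rule studentized_delta_method[where Y = Y and G = G and l = l and T = T and U = U and m = \<mu>,
        OF Y_indep Y_ident Y2 \<mu> _ _ openU \<mu>U pos T_meas])
    show "(G has_derivative l \<mu>) (at \<mu>)"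
      unfolding G_def[abs_def] l_def using \<mu>U by (intro sq_dist_proj_has_derivative) (simp add: U_def)
    show "isCont l \<mu>"
      unfolding l_def using \<mu>U by (intro isCont_sq_dist_proj_deriv) (simp add: U_def)
  qed (simp add: T_eq G\<mu>)
  with T_meas show ?thesis
    unfolding T_def[abs_def] by blast
qed

end
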